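(* Let $(U,V)$ be a pair of real Banach spaces such that (C) $U$ is a subspace of $V$ with compact inclusion $U\hookrightarrow V$. Let $\mathfrak{F}\in\mathcal{C}^1(\mathbb{R}\times U,V)$ satisfy: (F1) $\mathfrak{F}(\lambda,0)=0$ for all $\lambda\in\mathbb{R}$; (F2) $D_u\mathfrak{F}(\lambda,u)\in\Phi_0(U,V)$ for all $(\lambda,u)\in\mathbb{R}\times U$; (F3) $\mathfrak{F}$ is proper on closed and bounded subsets of $\mathbb{R}\times U$; (F4) the map $\mathfrak{N}(\lambda,u):=\mathfrak{F}(\lambda,u)-D_u\mathfrak{F}(\lambda,0)u$ admits a continuous extension to $\mathbb{R}\times V$; (F5) $\lambda_0$ is an isolated eigenvalue of $\mathfrak{L}(\lambda):=D_u\mathfrak{F}(\lambda,0)$ such that $N[\mathfrak{L}(\lambda_0)]=\mathrm{span}[\varphi_0]$ for some $\varphi_0\in U$ with $\|\varphi_0\|=1$. Suppose that for sufficiently small $\rho>0$, with $\lambda_-=\lambda_0-\rho$ and $\lambda_+=\lambda_0+\rho$, the integer $\chi[\mathfrak{L}_\omega,[\lambda_-,\lambda_+]]$ is odd, where $\mathfrak{L}_\omega:[\lambda_-,\lambda_+]\to\Phi_0(U,V)$ is any analytic admissible curve $\mathcal{A}$-homotopic to $\mathfrak{L}(\lambda)$, $\lambda\in[\lambda_-,\lambda_+]$. Then there exists a component $\mathfrak{C}$ of the set of nontrivial solutions $\mathcal{S}$ such that $(\lambda_0,0)\in\mathfrak{C}$ and, choosing $\varepsilon>0$ and $\delta>0$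 so small that $[\mathcal{S}\setminus\{(\lambda_0,0)\}]\cap B_\delta(\lambda_0,0)\subset Q_{\varepsilon,\eta}$, there exist two closed connected subsets $\mathfrak{C}_\delta^+,\mathfrak{C}_\delta^-\subset\mathfrak{C}\cap B_\delta(\lambda_0,0)$ such that $\mathfrak{C}_\delta^+\subset Q_{\varepsilon,\eta}^+\cup\{(\lambda_0,0)\}$, $\mathfrak{C}_\delta^-\subset Q_{\varepsilon,\eta}^-\cup\{(\lambda_0,0)\}$ and $\mathfrak{C}_\delta^+\cap\mathfrak{C}_\delta^-=\{(\lambda_0,0)\}$. Moreover, each of $\mathfrak{C}_\delta^+$ and $\mathfrak{C}_\delta^-$ links $(\lambda_0,0)$ to $\partial B_\delta(\lambda_0,0)$.
   Context: $\Phi_0(U,V)$: bounded linear Fredholm operators of index zero; $GL(U,V)$: topological isomorphisms; $\Sigma(\mathfrak{L})=\{\lambda:\mathfrak{L}(\lambda)\notin GL(U,V)\}$. $\mathcal{T}=\{(\lambda,0):\lambda\in\mathbb{R}\}$; $\mathcal{S}=[\mathfrak{F}^{-1}(0)\setminus\mathcal{T}]\cup\{(\lambda,0):\lambda\in\Sigma(\mathfrak{L})\}$; a component is a connected component. "Closed" is relative to $B_\delta(\lambda_0,0)$, and a set links $(\lambda_0,0)$ to $\partial B_\delta(\lambda_0,0)$ if it contains $(\lambda_0,0)$ and its closure meets $\partial B_\delta(\lambda_0,0)$. Cones: fix a closed subspace $Z\subset U$ with $U=N[\mathfrak{L}(\lambda_0)]\oplus Z$ and $\varphi_0^*\in U'$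 with $Z=N[\varphi_0^*]$ and $\langle\varphi_0^*,\varphi_0\rangle=1$. Fix a continuous functional $\psi:U\to\mathbb{R}$ with $\psi(0)=0$ and $C_1\|u\|\leq\psi(u)\leq C_2\|u\|$ for all $u\in U$, for constants $0<C_1<C_2$, and fix $\eta\in(0,1/C_2)$. For $\varepsilon>0$: $Q_{\varepsilon,\eta}=\{(\lambda,u)\in\mathbb{R}\times U:|\lambda-\lambda_0|<\varepsilon,\ |\langle\varphi_0^*,u\rangle|>\eta\psi(u)\}$, $Q_{\varepsilon,\eta}^+=\{|\lambda-\lambda_0|<\varepsilon,\ \langle\varphi_0^*,u\rangle>\eta\psi(u)\}$, $Q_{\varepsilon,\eta}^-=\{|\lambda-\lambda_0|<\varepsilon,\ \langle\varphi_0^*,u\rangle<-\eta\psi(u)\}$. Under (C), (F1)--(F5), for sufficiently small $\varepsilon>0$ there is $\delta_0=\delta_0(\eta)>0$ such that the inclusion $[\mathcal{S}\setminus\{(\lambda_0,0)\}]\cap B_\delta(\lambda_0,0)\subset Q_{\varepsilon,\eta}$ holds for all $\delta\in(0,\delta_0)$. $\mathcal{A}$-homotopy: a continuous path $[a,b]\to\Phi_0(U,V)$ is admissible if its endpoints lie in $GL(U,V)$; two admissible paths are $\mathcal{A}$-homotopic if they are homotopic through a continuous homotopy in $\Phi_0(U,V)$ whose endpoints stay in $GL(U,V)$. Every admissible path is $\mathcal{A}$-homotopic to an analytic one. Generalized algebraic multiplicity $\chi$: for a $\mathcal{C}^r$ curve $\mathfrak{L}$ in $\Phi_0(U,V)$,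 $\mu\in\Sigma(\mathfrak{L})$ is $\kappa$-algebraic ($1\leq\kappa\leq r$) if there are $\epsilon,C>0$ with $\mathfrak{L}(\lambda)\in GL(U,V)$ and $\|\mathfrak{L}(\lambda)^{-1}\|<C|\lambda-\mu|^{-\kappa}$ for $0<|\lambda-\mu|<\epsilon$, $\kappa$ minimal. Put $\mathfrak{L}_j=\frac1{j!}\mathfrak{L}^{(j)}(\mu)$. $\mu$ is $\kappa$-transversal if $\bigoplus_{j=1}^{\kappa}\mathfrak{L}_j\big(\bigcap_{i=0}^{j-1}N[\mathfrak{L}_i]\big)\oplus R[\mathfrak{L}_0]=V$ with $\mathfrak{L}_\kappa\big(\bigcap_{i=0}^{\kappa-1}N[\mathfrak{L}_i]\big)\neq\{0\}$; then $\chi[\mathfrak{L},\mu]:=\sum_{j=1}^{\kappa}j\dim\mathfrak{L}_j\big(\bigcap_{i=0}^{j-1}N[\mathfrak{L}_i]\big)$. In general there is an $\mathcal{L}(U)$-valued polynomial $\Phi$ with $\Phi(\mu)=I_U$ such that $\mu$ is $\kappa$-transversal for $\mathfrak{L}^\Phi(\lambda)=\mathfrak{L}(\lambda)\Phi(\lambda)$, and $\chi[\mathfrak{L},\mu]:=\chi[\mathfrak{L}^\Phi,\mu]$, independently of $\Phi$. For analytic admissible $\mathfrak{L}_\omega$ on $[a,b]$, $\Sigma(\mathfrak{L}_\omega)$ is finite, consists of algebraic eigenvalues, and $\chi[\mathfrak{L}_\omega,[a,b]]:=\sum_{\mu\in\Sigma(\mathfrak{L}_\omega)}\chi[\mathfrak{L}_\omega,\mu]$.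 *)

theory Defs
  imports "HOL-Analysis.Analysis"
begin

section \<open>Fredholm operators\<close>

definition finite_dimensional :: "'a::real_vector set \<Rightarrow> bool" where
  "finite_dimensional W \<longleftrightarrow> (\<exists>B. finite B \<and> span B = W)"

definition null_space :: "('u::real_normed_vector \<Rightarrow>\<^sub>L 'v::real_normed_vector) \<Rightarrow> 'u set" where
  "null_space T = {u. blinfun_apply T u = 0}"

definition complementary :: "'a::real_vector set \<Rightarrow> 'a set \<Rightarrow> bool" where
  "complementary A B \<longleftrightarrow>
     subspace A \<and> subspace B \<and> A \<inter> B = {0} \<and> {a + b | a b. a \<in> A \<and> b \<in> B} = UNIV"

definition finite_codimensional :: "'a::real_vector set \<Rightarrow> bool" where
  "finite_codimensional S \<longleftrightarrow> (\<exists>W. complementary S W \<and> finite_dimensional W)"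

text \<open>All complements of a subspace are isomorphic to the quotient, so they have the same
  dimension; the value is meaningful for finite-codimensional subspaces.\<close>

definition codim :: "'a::real_vector set \<Rightarrow> nat" where
  "codim S = (THE n. \<exists>W. complementary S W \<and> finite_dimensional W \<and> dim W = n)"

definition fredholm :: "('u::real_normed_vector \<Rightarrow>\<^sub>L 'v::real_normed_vector) \<Rightarrow> bool" where
  "fredholm T \<longleftrightarrow> finite_dimensional (null_space T) \<and> closed (range (blinfun_apply T)) \<and>
     finite_codimensional (range (blinfun_apply T))"

definition fredholm_index :: "('u::real_normed_vector \<Rightarrow>\<^sub>L 'v::real_normed_vector) \<Rightarrow> int" where
  "fredholm_index T = int (dim (null_space T)) - int (codim (range (blinfun_apply T)))"

definition Fredholm0 :: "('u::real_normed_vector \<Rightarrow>\<^sub>L 'v::real_normed_vector) set" where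
  "Fredholm0 = {T. fredholm T \<and> fredholm_index T = 0}"

definition GL :: "('u::real_normed_vector \<Rightarrow>\<^sub>L 'v::real_normed_vector) set" where
  "GL = {T. bij (blinfun_apply T) \<and> bounded_linear (inv (blinfun_apply T))}"

definition inverse_op ::
  "('u::real_normed_vector \<Rightarrow>\<^sub>L 'v::real_normed_vector) \<Rightarrow> ('v \<Rightarrow>\<^sub>L 'u)" where
  "inverse_op T = Blinfun (inv (blinfun_apply T))"

definition gen_spectrum ::
  "(real \<Rightarrow> ('u::real_normed_vector \<Rightarrow>\<^sub>L 'v::real_normed_vector)) \<Rightarrow> real set" where
  "gen_spectrum L = {t. L t \<notin> GL}"


section \<open>Admissible curves\<close>

definition admissible ::
  "real \<Rightarrow> real \<Rightarrow> (real \<Rightarrow> ('u::real_normed_vector \<Rightarrow>\<^sub>L 'v::real_normed_vector)) \<Rightarrow> bool" where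
  "admissible a b L \<longleftrightarrow>
     continuous_on {a..b} L \<and> L ` {a..b} \<subseteq> Fredholm0 \<and> L a \<in> GL \<and> L b \<in> GL"

definition A_homotopic ::
  "real \<Rightarrow> real \<Rightarrow> (real \<Rightarrow> ('u::real_normed_vector \<Rightarrow>\<^sub>L 'v::real_normed_vector)) \<Rightarrow>
   (real \<Rightarrow> ('u \<Rightarrow>\<^sub>L 'v)) \<Rightarrow> bool" where
  "A_homotopic a b L M \<longleftrightarrow> admissible a b L \<and> admissible a b M \<and>
     homotopic_with_canon (\<lambda>p. p a \<in> GL \<and> p b \<in> GL) {a..b} Fredholm0 L M"

text \<open>Real analyticity of a curve on a (possibly closed) interval. At an end point the power
  series is only compared with the curve on one side; it then converges on both sides and
  provides an analytic extension.\<close>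

definition real_analytic_curve :: "real set \<Rightarrow> (real \<Rightarrow> 'a::real_normed_vector) \<Rightarrow> bool" where
  "real_analytic_curve S f \<longleftrightarrow>
     (\<forall>x\<in>S. \<exists>r>0. \<exists>c. \<forall>y\<in>S. \<bar>y - x\<bar> < r \<longrightarrow> (\<lambda>n. (y - x) ^ n *\<^sub>R c n) sums f y)"


section \<open>The generalized algebraic multiplicity\<close>

text \<open>The curve is assumed to be as smooth as needed near the point; below, the notions
  are only applied to analytic curves.\<close>

definition taylor_coeff :: "(real \<Rightarrow> 'a::real_normed_vector) \<Rightarrow> real \<Rightarrow> nat \<Rightarrow> 'a" where
  "taylor_coeff L \<mu> j = (1 / fact j) *\<^sub>R ((\<lambda>f t. vector_derivative f (at t)) ^^ j) L \<mu>"

definition inverse_growth ::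
  "(real \<Rightarrow> ('u::real_normed_vector \<Rightarrow>\<^sub>L 'v::real_normed_vector)) \<Rightarrow> real \<Rightarrow> nat \<Rightarrow> bool" where
  "inverse_growth L \<mu> \<kappa> \<longleftrightarrow>
     (\<exists>\<epsilon>>0. \<exists>C>0. \<forall>t. 0 < \<bar>t - \<mu>\<bar> \<and> \<bar>t - \<mu>\<bar> < \<epsilon> \<longrightarrow>
        L t \<in> GL \<and> norm (inverse_op (L t)) < C / \<bar>t - \<mu>\<bar> ^ \<kappa>)"

definition algebraic_eigenvalue ::
  "(real \<Rightarrow> ('u::real_normed_vector \<Rightarrow>\<^sub>L 'v::real_normed_vector)) \<Rightarrow> real \<Rightarrow> nat \<Rightarrow> bool" where
  "algebraic_eigenvalue L \<mu> \<kappa> \<longleftrightarrow> \<mu> \<in> gen_spectrum L \<and> 1 \<le> \<kappa> \<and> inverse_growth L \<mu> \<kappa> \<and>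
     (\<forall>k. 1 \<le> k \<and> k < \<kappa> \<longrightarrow> \<not> inverse_growth L \<mu> k)"

text \<open>The summand with index 0 is the range of the zeroth coefficient.\<close>

definition trans_summand ::
  "(real \<Rightarrow> ('u::real_normed_vector \<Rightarrow>\<^sub>L 'v::real_normed_vector)) \<Rightarrow> real \<Rightarrow> nat \<Rightarrow> 'v set" where
  "trans_summand L \<mu> j =
     blinfun_apply (taylor_coeff L \<mu> j) ` (\<Inter>i<j. null_space (taylor_coeff L \<mu> i))"

text \<open>The direct sum decomposition says that every vector is in exactly one way a sum of
  elements of the summands.\<close>

definition transversal ::
  "(real \<Rightarrow> ('u::real_normed_vector \<Rightarrow>\<^sub>L 'v::real_normed_vector)) \<Rightarrow> real \<Rightarrow> nat \<Rightarrow> bool" where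
  "transversal L \<mu> \<kappa> \<longleftrightarrow> 1 \<le> \<kappa> \<and>
     bij_betw (\<lambda>w. \<Sum>j\<le>\<kappa>. w j) (\<Pi>\<^sub>E j\<in>{..\<kappa>}. trans_summand L \<mu> j) UNIV \<and>
     trans_summand L \<mu> \<kappa> \<noteq> {0}"

definition transversal_mult ::
  "(real \<Rightarrow> ('u::real_normed_vector \<Rightarrow>\<^sub>L 'v::real_normed_vector)) \<Rightarrow> real \<Rightarrow> nat \<Rightarrow> nat" where
  "transversal_mult L \<mu> \<kappa> = (\<Sum>j=1..\<kappa>. j * dim (trans_summand L \<mu> j))"

definition polynomial_curve :: "(real \<Rightarrow> 'a::real_vector) \<Rightarrow> bool" where
  "polynomial_curve \<Phi> \<longleftrightarrow> (\<exists>n A. \<forall>t. \<Phi> t = (\<Sum>i\<le>n. t ^ i *\<^sub>R A i))"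

text \<open>At an algebraic eigenvalue a transversalizing polynomial exists, and the resulting number
  does not depend on its choice.\<close>

definition alg_mult ::
  "(real \<Rightarrow> ('u::real_normed_vector \<Rightarrow>\<^sub>L 'v::real_normed_vector)) \<Rightarrow> real \<Rightarrow> nat" where
  "alg_mult L \<mu> = (THE m. \<exists>\<kappa> \<Phi>. algebraic_eigenvalue L \<mu> \<kappa> \<and>
     polynomial_curve \<Phi> \<and> \<Phi> \<mu> = id_blinfun \<and>
     transversal (\<lambda>t. L t o\<^sub>L \<Phi> t) \<mu> \<kappa> \<and>
     m = transversal_mult (\<lambda>t. L t o\<^sub>L \<Phi> t) \<mu> \<kappa>)"

definition total_mult ::
  "(real \<Rightarrow> ('u::real_normed_vector \<Rightarrow>\<^sub>L 'v::real_normed_vector)) \<Rightarrow> real \<Rightarrow> real \<Rightarrow> nat" where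
  "total_mult L a b = (\<Sum>\<mu> \<in> gen_spectrum L \<inter> {a..b}. alg_mult L \<mu>)"


section \<open>The nonlinear problem\<close>

definition C1_map :: "('a::real_normed_vector \<Rightarrow> 'b::real_normed_vector) \<Rightarrow> bool" where
  "C1_map f \<longleftrightarrow> (\<exists>f' :: 'a \<Rightarrow> ('a \<Rightarrow>\<^sub>L 'b).
     (\<forall>x. (f has_derivative blinfun_apply (f' x)) (at x)) \<and> continuous_on UNIV f')"

definition D\<^sub>u ::
  "(real \<times> 'u::real_normed_vector \<Rightarrow> 'v::real_normed_vector) \<Rightarrow> real \<Rightarrow> 'u \<Rightarrow> ('u \<Rightarrow>\<^sub>L 'v)" where
  "D\<^sub>u F t u = Blinfun (frechet_derivative (\<lambda>v. F (t, v)) (at u))"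

definition linearization ::
  "(real \<times> 'u::real_normed_vector \<Rightarrow> 'v::real_normed_vector) \<Rightarrow> real \<Rightarrow> ('u \<Rightarrow>\<^sub>L 'v)" where
  "linearization F t = D\<^sub>u F t 0"

definition nonlinear_part ::
  "(real \<times> 'u::real_normed_vector \<Rightarrow> 'v::real_normed_vector) \<Rightarrow> real \<Rightarrow> 'u \<Rightarrow> 'v" where
  "nonlinear_part F t u = F (t, u) - blinfun_apply (linearization F t) u"

definition trivial_branch :: "(real \<times> 'u::real_normed_vector) set" where
  "trivial_branch = {(t, 0) | t. True}"

definition nontrivial_solutions ::
  "(real \<times> 'u::real_normed_vector \<Rightarrow> 'v::real_normed_vector) \<Rightarrow> (real \<times> 'u) set" where
  "nontrivial_solutions F =
     (F -` {0} - trivial_branch) \<union> {(t, 0) | t. t \<in> gen_spectrum (linearization F)}"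

text \<open>A subspace that carries its own norm is represented by its inclusion map.\<close>

definition compact_inclusion :: "('u::real_normed_vector \<Rightarrow> 'v::real_normed_vector) \<Rightarrow> bool" where
  "compact_inclusion \<iota> \<longleftrightarrow> bounded_linear \<iota> \<and> inj \<iota> \<and>
     (\<forall>B. bounded B \<longrightarrow> compact (closure (\<iota> ` B)))"

definition Q_cone ::
  "real \<Rightarrow> ('u::real_normed_vector \<Rightarrow>\<^sub>L real) \<Rightarrow> ('u \<Rightarrow> real) \<Rightarrow> real \<Rightarrow> real \<Rightarrow> (real \<times> 'u) set" where
  "Q_cone l\<^sub>0 \<phi>s \<psi> \<epsilon> \<eta> =
     {(t, u). \<bar>t - l\<^sub>0\<bar> < \<epsilon> \<and> \<bar>blinfun_apply \<phi>s u\<bar> > \<eta> * \<psi> u}"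

definition Q_cone_pos ::
  "real \<Rightarrow> ('u::real_normed_vector \<Rightarrow>\<^sub>L real) \<Rightarrow> ('u \<Rightarrow> real) \<Rightarrow> real \<Rightarrow> real \<Rightarrow> (real \<times> 'u) set" where
  "Q_cone_pos l\<^sub>0 \<phi>s \<psi> \<epsilon> \<eta> =
     {(t, u). \<bar>t - l\<^sub>0\<bar> < \<epsilon> \<and> blinfun_apply \<phi>s u > \<eta> * \<psi> u}"

definition Q_cone_neg ::
  "real \<Rightarrow> ('u::real_normed_vector \<Rightarrow>\<^sub>L real) \<Rightarrow> ('u \<Rightarrow> real) \<Rightarrow> real \<Rightarrow> real \<Rightarrow> (real \<times> 'u) set" where
  "Q_cone_neg l\<^sub>0 \<phi>s \<psi> \<epsilon> \<eta> =
     {(t, u). \<bar>t - l\<^sub>0\<bar> < \<epsilon> \<and> blinfun_apply \<phi>s u < - \<eta> * \<psi> u}"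

definition links_to_boundary :: "'a::metric_space set \<Rightarrow> 'a \<Rightarrow> real \<Rightarrow> bool" where
  "links_to_boundary C p \<delta> \<longleftrightarrow> p \<in> C \<and> closure C \<inter> frontier (ball p \<delta>) \<noteq> {}"

end

theory Submission
  imports Defs
begin

text \<open>
  Near \<open>\<lambda>\<^sub>0\<close> the linearization factors as \<open>L(\<lambda>) = M(\<lambda>) (I - \<phi> \<otimes> w(\<lambda>))\<close> with \<open>M(\<lambda>)\<close>
  invertible, so that \<open>\<alpha> = 1 - \<phi>(w)\<close> vanishes exactly on the spectrum. If \<open>\<alpha>\<close> had the same sign on
  both sides of \<open>\<lambda>\<^sub>0\<close>, the curve would be homotopic to a constant invertible one, whose multiplicity
  is zero; hence odd multiplicity forces \<open>\<alpha>\<close> to change sign.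

  With \<open>r = \<phi>(u)\<close> the equation \<open>F(\<lambda>, u) = 0\<close> becomes the compact fixed point problem
  \<open>u = r w - M\<inverse>N(\<lambda>, u)\<close>, \<open>r \<alpha>(\<lambda>) + \<phi>(M\<inverse>N(\<lambda>, u)) = 0\<close>. Replacing \<open>N(\<lambda>, u)\<close> by \<open>N(\<lambda>, s u) / s\<close> with a
  cutoff \<open>s\<close> extends the problem to all \<open>u\<close>; it is linear far out and, the cone being invariant under
  dilations, it has no solutions with small \<open>r\<close> away from \<open>(\<lambda>\<^sub>0, 0)\<close>. If the component of \<open>(\<lambda>\<^sub>0, 0)\<close>
  in the half cone stayed inside the ball, the solution set would split into two compact pieces;
  letting \<open>r\<close> be a Urysohn function that is too large on the piece containing \<open>(\<lambda>\<^sub>0, 0)\<close> and too small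
  on the other one gives a problem without solutions, against Schauder's theorem.
\<close>

text \<open>The radius \<open>\<delta>\<close> is any one for which the cone inclusion holds, so a
  reduction valid only very near \<open>l\<^sub>0\<close> is not enough: \<open>M\<close> has to
  stay invertible on a whole parameter interval. The cone condition makes this possible. At a
  trivial point it would read 0 < 0, so the interval contains no eigenvalue other than
  \<open>l\<^sub>0\<close>; at the other solutions it bounds the norm by a multiple of
  \<open>r\<close>. Schauder's theorem does the work of a degree computation, but wants a map of the
  whole product space into a compact set. This is the origin of the cutoff and of a clamp on the
  parameter. The scalar equation \<open>y = 0\<close> is encoded by asking that the clamped step
  \<open>t - \<sigma> * y\<close> return \<open>t\<close>. At both ends of the interval the cutoff
  has removed the nonlinearity, \<open>y\<close> is \<open>r\<close> times \<alpha>, and the step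
  points inwards, so a fixed point has \<open>y = 0\<close>. Here alone the opposite signs of
  \<alpha> matter; elsewhere it only has to be nonzero off \<open>l\<^sub>0\<close>. Keeping
  \<open>r\<close> above a positive constant makes the fixed point nontrivial. The negative half is
  the same statement for \<open>- \<phi>s\<close> and \<open>- \<phi>\<^sub>0\<close>.\<close>

section \<open>Compactness and separation in metric spaces\<close>

lemma compact_convergent_subseq:
  fixes s :: "nat \<Rightarrow> 'a::metric_space"
  assumes "compact C" "\<And>n. s n \<in> C"
  obtains l r where "l \<in> C" "strict_mono r" "(\<lambda>n. s (r n)) \<longlonglongrightarrow> l"
proof -
  have "\<exists>l\<in>C. \<exists>r. strict_mono r \<and> (s \<circ> r) \<longlonglongrightarrow> l"
    using assms by (simp add: compact_def)
  then show ?thesis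
    using that by (auto simp: o_def)
qed

lemma Urysohn_real_metric:
  fixes S T :: "'a::metric_space set" and a b :: real
  assumes "closed S" "closed T" "S \<inter> T = {}" "a \<le> b"
  obtains f where "continuous_on UNIV f" "\<And>x. f x \<in> {a..b}"
    "\<And>x. x \<in> S \<Longrightarrow> f x = a" "\<And>x. x \<in> T \<Longrightarrow> f x = b"
proof -
  have "normal_space (euclidean :: 'a topology)"
    by (simp add: metrizable_imp_normal_space metrizable_space_euclidean)
  then obtain f where f: "continuous_map euclidean (top_of_set {a..b}) f"
      "f ` S \<subseteq> {a}" "f ` T \<subseteq> {b}"
    using Urysohn_lemma[of euclidean S T a b] assms by (auto simp: disjnt_def)
  then have "continuous_on UNIV f" "\<And>x. f x \<in> {a..b}"
    by (auto simp: continuous_map_in_subtopology)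
  with f show ?thesis
    by (intro that[of f]) auto
qed

text \<open>A connected subset of \<open>K\<close> through \<open>x\<close> lies in the component of
  \<open>x\<close> and so misses \<open>A\<close>. The cut wire fence theorem for compact Hausdorff
  spaces turns the absence of a connected set joining \<open>x\<close> to
  \<open>K \<inter> A\<close> into a splitting of \<open>K\<close> into two closed pieces.\<close>

lemma compact_component_separation:
  fixes K A :: "'a::metric_space set"
  assumes K: "compact K" and x: "x \<in> K" and A: "closed A"
    and dis: "connected_component_set K x \<inter> A = {}"
  obtains K1 K2 where "compact K1" "compact K2" "K1 \<union> K2 = K" "K1 \<inter> K2 = {}"
    "x \<in> K1" "K \<inter> A \<subseteq> K2"
proof -
  let ?X = "top_of_set K"
  have "separated_between ?X {x} (K \<inter> A)"
  proof (rule cut_wire_fence_theorem)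
    show "compact_space ?X"
      using K by (simp add: compact_space_subtopology)
    show "Hausdorff_space ?X"
      by (simp add: Hausdorff_space_subtopology)
    show "closedin ?X {x}" "closedin ?X (K \<inter> A)"
      using x A by (auto intro: closed_subset closedin_closed_Int)
    show "disjnt C {x} \<or> disjnt C (K \<inter> A)" if "connectedin ?X C" for C
    proof -
      have C: "C \<subseteq> K" "connected C"
        using that by (auto simp: connectedin_subtopology)
      show ?thesis
        using C dis connected_component_maximal[of x C K] by (auto simp: disjnt_def)
    qed
  qed
  then obtain U V where UV: "closedin ?X U" "closedin ?X V" "U \<union> V = K" "disjnt U V" "x \<in> U" "K \<inter> A \<subseteq> V"
    by (auto simp: separated_between_alt)
  then show ?thesis
    using K by (intro that[of U V]) (auto simp: disjnt_def closedin_compact)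
qed

section \<open>Schauder's fixed point theorem\<close>

text \<open>The number of coordinates is a variable, so the library form of Brouwer's theorem, which
  lives on a fixed Euclidean type, does not apply; Kuhn's lemma does.\<close>

lemma approximate_fixed_point_cube:
  fixes g :: "(nat \<Rightarrow> real) \<Rightarrow> nat \<Rightarrow> real"
  assumes range: "\<And>t i. \<forall>j<n. t j \<in> {0..1} \<Longrightarrow> i < n \<Longrightarrow> g t i \<in> {0..1}"
    and unif: "\<And>e. e > 0 \<Longrightarrow> \<exists>d>0. \<forall>t t'. (\<forall>j<n. t j \<in> {0..1} \<and> t' j \<in> {0..1} \<and> \<bar>t j - t' j\<bar> \<le> d)
                  \<longrightarrow> (\<forall>i<n. \<bar>g t i - g t' i\<bar> \<le> e)"
    and e: "e > 0"
  shows "\<exists>t. (\<forall>j<n. t j \<in> {0..1} \<and> \<bar>g t j - t j\<bar> \<le> e)"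
proof -
  obtain d where d: "d > 0" and D: "\<And>t t'. (\<forall>j<n. t j \<in> {0..1} \<and> t' j \<in> {0..1} \<and> \<bar>t j - t' j\<bar> \<le> d)
                  \<Longrightarrow> (\<forall>i<n. \<bar>g t i - g t' i\<bar> \<le> e/2)"
    using unif[of "e/2"] e by (meson half_gt_zero)
  \<comment> \<open>The mesh \<open>1 / p\<close> is at most \<open>d\<close>, so \<open>g\<close>
    changes by at most \<open>e/2\<close> between a vertex and the corner of its cell, and at most
    \<open>e/2\<close> itself; the two errors add up to \<open>e\<close>.\<close>
  obtain p :: nat where p: "1 / d + 2 / e < p"
    using reals_Archimedean2 by blast
  have p0: "0 < p" using p d e
    by (smt (verit) divide_pos_pos of_nat_0 gr0I)
  have "1 / d < p" "2 / e < p"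
    using p d e by (smt (verit) divide_pos_pos)+
  then have pd: "1 / p \<le> d" and pe: "1 / p \<le> e / 2"
    using d e p0 by (auto simp: field_simps)
  define sc where "sc x = (\<lambda>i. real (x i) / p)" for x :: "nat \<Rightarrow> nat"
  \<comment> \<open>Label 0 where \<open>g\<close> does not decrease the coordinate, 1 where it
    does. On the two faces the values demanded by Kuhn's lemma are imposed; \<open>lab0\<close> and
    \<open>lab1\<close> survive there because \<open>g\<close> takes its values in the unit
    interval.\<close>
  define label where "label x i = (if x i = p then 1 else if x i = 0 then 0 else if g (sc x) i \<ge> sc x i then 0 else 1 :: nat)" for x i
  have sc: "sc x j \<in> {0..1}" if "x j \<le> p" for x j
    using that p0 by (auto simp: sc_def)
  obtain q where q: "\<forall>i<n. q i < p" and
    qq: "\<forall>i<n. \<exists>r s. (\<forall>j<n. q j \<le> r j \<and> r j \<le> q j + 1) \<and> (\<forall>j<n. q j \<le> s j \<and> s j \<le> q j + 1) \<and> label r i \<noteq> label s i"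
    by (rule kuhn_lemma[of p n label]) (use p0 in \<open>auto simp: label_def\<close>)
  have lab0: "g (sc x) i \<ge> sc x i" if "label x i = 0" "\<forall>j<n. x j \<le> p" "i < n" for x i
  proof (cases "x i = 0")
    case True
    then show ?thesis using range[of "sc x" i] sc that by (auto simp: sc_def)
  next
    case False
    then show ?thesis using that by (auto simp: label_def split: if_splits)
  qed
  have lab1: "g (sc x) i \<le> sc x i" if "label x i \<noteq> 0" "\<forall>j<n. x j \<le> p" "i < n" for x i
  proof (cases "x i = p")
    case True
    then have "sc x i = 1" using p0 by (simp add: sc_def)
    moreover have "g (sc x) i \<in> {0..1}"
      by (rule range) (use sc that in auto)
    ultimately show ?thesis by simp
  next
    case False
    then show ?thesis using that by (auto simp: label_def split: if_splits)
  qed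
  have rp: "\<forall>j<n. r j \<le> p" if "\<forall>j<n. q j \<le> r j \<and> r j \<le> q j + 1" for r
    using that q by (metis Suc_eq_plus1 Suc_leI le_trans)
  have near: "\<bar>sc r i - sc q i\<bar> \<le> 1 / p" if "\<forall>j<n. q j \<le> r j \<and> r j \<le> q j + 1" "i < n" for r i
  proof -
    have "q i \<le> r i" "r i \<le> q i + 1"
      using that by auto
    then have "\<bar>real (r i) - real (q i)\<bar> \<le> 1" by linarith
    then have "\<bar>real (r i) - real (q i)\<bar> / p \<le> 1 / p"
      by (intro divide_right_mono) auto
    then show ?thesis
      by (simp add: sc_def flip: diff_divide_distrib)
  qed
  have gnear: "\<bar>g (sc r) i - g (sc q) i\<bar> \<le> e/2" if r: "\<forall>j<n. q j \<le> r j \<and> r j \<le> q j + 1" "i < n" for r i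
  proof -
    have "\<forall>j<n. sc r j \<in> {0..1} \<and> sc q j \<in> {0..1} \<and> \<bar>sc r j - sc q j\<bar> \<le> d"
    proof (intro allI impI conjI)
      fix j assume j: "j < n"
      have "r j \<le> p" "q j \<le> p"
        using rp[OF r(1)] q j by (auto intro: less_imp_le)
      then show "sc r j \<in> {0..1}" "sc q j \<in> {0..1}" using sc by auto
      show "\<bar>sc r j - sc q j\<bar> \<le> d" using near[OF r(1) j] pd by simp
    qed
    from D[OF this] r show ?thesis by auto
  qed
  show ?thesis
  proof (intro exI[of _ "sc q"] allI impI conjI)
    fix i assume i: "i < n"
    show "sc q i \<in> {0..1}" using q i sc by (auto intro: less_imp_le)
    obtain r s where r: "\<forall>j<n. q j \<le> r j \<and> r j \<le> q j + 1"
      and s: "\<forall>j<n. q j \<le> s j \<and> s j \<le> q j + 1" and rs: "label r i \<noteq> label s i"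
      using qq i by blast
    \<comment> \<open>In coordinate \<open>i\<close> one vertex of the cell is not moved down and
      another is not moved up. Both are close to \<open>q\<close>, so \<open>q\<close> is almost
      fixed in that coordinate; here the two vertices are only put in order.\<close>
    have "\<exists>r s. (\<forall>j<n. q j \<le> r j \<and> r j \<le> q j + 1) \<and> (\<forall>j<n. q j \<le> s j \<and> s j \<le> q j + 1)
        \<and> label r i = 0 \<and> label s i \<noteq> 0"
    proof (cases "label r i = 0")
      case True
      then show ?thesis using r s rs by (intro exI[of _ r] exI[of _ s]) auto
    next
      case False
      then have "label s i = 0"
        using rs by (auto simp: label_def split: if_splits)
      then show ?thesis using r s False by (intro exI[of _ s] exI[of _ r]) auto
    qed
    then obtain r s where r: "\<forall>j<n. q j \<le> r j \<and> r j \<le> q j + 1"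
      and s: "\<forall>j<n. q j \<le> s j \<and> s j \<le> q j + 1" and rs: "label r i = 0" "label s i \<noteq> 0"
      by blast
    have "g (sc r) i \<ge> sc r i" "g (sc s) i \<le> sc s i"
      using lab0[OF rs(1) rp[OF r] i] lab1[OF rs(2) rp[OF s] i] by auto
    then show "\<bar>g (sc q) i - sc q i\<bar> \<le> e"
      using near[OF r i] near[OF s i] gnear[OF r i] gnear[OF s i] pe by linarith
  qed
qed

text \<open>Adding one vector at a time exhibits the set as a continuous image of a product of
  compacts. The weights fill the whole cube, not just the simplex, to match the domain of the
  approximate fixed point lemma.\<close>

lemma compact_combination_cube:
  fixes x :: "nat \<Rightarrow> 'a::real_normed_vector"
  shows "compact {(\<Sum>i<n. t i *\<^sub>R x i) | t. \<forall>i<n. t i \<in> {0..1::real}}"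
proof (induction n)
  case (Suc n)
  let ?S = "\<lambda>n. {(\<Sum>i<n. t i *\<^sub>R x i) | t. \<forall>i<n. t i \<in> {0..1::real}}"
  have "compact ((\<lambda>(a, s). a + s *\<^sub>R x n) ` (?S n \<times> {0..1}))"
    by (intro compact_continuous_image compact_Times Suc)
      (auto simp: case_prod_beta intro!: continuous_intros)
  also have "(\<lambda>(a, s). a + s *\<^sub>R x n) ` (?S n \<times> {0..1}) = ?S (Suc n)"
  proof (intro equalityI subsetI)
    fix y assume "y \<in> (\<lambda>(a, s). a + s *\<^sub>R x n) ` (?S n \<times> {0..1})"
    then obtain t s where "\<forall>i<n. t i \<in> {0..1}" "s \<in> {0..1}" "y = (\<Sum>i<n. t i *\<^sub>R x i) + s *\<^sub>R x n"
      by auto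
    then show "y \<in> ?S (Suc n)"
      by (auto intro!: exI[of _ "t(n := s)"] simp: less_Suc_eq)
  next
    fix y assume "y \<in> ?S (Suc n)"
    then obtain t where "\<forall>i<Suc n. t i \<in> {0..1}" "y = (\<Sum>i<n. t i *\<^sub>R x i) + t n *\<^sub>R x n"
      by auto
    then show "y \<in> (\<lambda>(a, s). a + s *\<^sub>R x n) ` (?S n \<times> {0..1})"
      by (intro image_eqI[of _ _ "(\<Sum>i<n. t i *\<^sub>R x i, t n)"]) auto
  qed
  finally show ?case .
qed auto

text \<open>Schauder projection: replacing \<open>f x\<close> by an average of nearby points of a
  finite \<open>e/2\<close>-net costs at most \<open>e/2\<close> and leaves a problem for finitely
  many weights. Since all values lie in \<open>C\<close>, a subsequence of values converges, and the
  approximate fixed points converge along with it.\<close>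

theorem Schauder_fixed_point:
  fixes f :: "'a::real_normed_vector \<Rightarrow> 'a"
  assumes cont: "continuous_on UNIV f" and C: "compact C" and fC: "\<And>x. f x \<in> C"
  shows "\<exists>x. f x = x"
proof -
  have approx: "\<exists>x. norm (x - f x) \<le> e" if e: "e > 0" for e
  proof -
    obtain k where k: "finite k" "C \<subseteq> (\<Union>x\<in>k. ball x (e/2))"
      using C e seq_compact_imp_totally_bounded[of C] compact_eq_seq_compact_metric
      by (metis half_gt_zero)
    obtain n x where kx: "k = x ` {..<n::nat}"
      using k(1) by (metis finite_imp_nat_seg_image_inj_on lessThan_def)
    \<comment> \<open>Tents of radius \<open>e/2\<close> around the net points. At each point of
      \<open>C\<close> some tent is positive, so dividing by the sum \<open>M\<close> gives a
      partition of unity on \<open>C\<close> in which only net points nearer than \<open>e/2\<close>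
      carry weight.\<close>
    define m where "m i y = max 0 (e/2 - dist (x i) y)" for i y
    define M where "M y = (\<Sum>i<n. m i y)" for y
    have m0: "m i y \<ge> 0" for i y by (simp add: m_def)
    have M0: "M y > 0" if "y \<in> C" for y
    proof -
      have "y \<in> (\<Union>x\<in>k. ball x (e/2))"
        using k(2) that by blast
      then obtain i where "i < n" "dist (x i) y < e/2"
        using kx by (auto simp: mem_ball)
      then have "m i y > 0" by (simp add: m_def)
      moreover have "m i y \<le> M y"
        unfolding M_def using \<open>i < n\<close> m0 by (intro member_le_sum) auto
      ultimately show ?thesis by simp
    qed
    define \<mu> where "\<mu> i y = m i y / M y" for i y
    have \<mu>1: "(\<Sum>i<n. \<mu> i y) = 1" if "y \<in> C" for y
      using M0[OF that] unfolding \<mu>_def M_def by (simp flip: sum_divide_distrib)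
    have \<mu>0: "\<mu> i y \<ge> 0" if "y \<in> C" for i y
      using M0[OF that] m0 by (simp add: \<mu>_def)
    have \<mu>le: "\<mu> i y \<in> {0..1}" if "y \<in> C" "i < n" for i y
      using member_le_sum[of i "{..<n}" "\<lambda>i. \<mu> i y"] \<mu>0[OF that(1)] \<mu>1[OF that(1)] that(2) by auto
    have proj: "norm ((\<Sum>i<n. \<mu> i y *\<^sub>R x i) - y) \<le> e/2" if y: "y \<in> C" for y
    proof -
      have "(\<Sum>i<n. \<mu> i y *\<^sub>R x i) - y = (\<Sum>i<n. \<mu> i y *\<^sub>R (x i - y))"
        using \<mu>1[OF y] by (simp add: scaleR_diff_right sum_subtractf flip: scaleR_sum_left)
      also have "norm \<dots> \<le> (\<Sum>i<n. \<mu> i y * (e/2))"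
      proof (rule sum_norm_le)
        fix i
        show "norm (\<mu> i y *\<^sub>R (x i - y)) \<le> \<mu> i y * (e/2)"
        proof (cases "m i y = 0")
          case False
          then have "norm (x i - y) \<le> e/2" by (auto simp: m_def dist_norm max_def split: if_splits)
          then have "\<mu> i y * norm (x i - y) \<le> \<mu> i y * (e/2)"
            using \<mu>0[OF y] by (intro mult_left_mono) auto
          then show ?thesis using \<mu>0[OF y] by simp
        qed (simp add: \<mu>_def)
      qed
      also have "\<dots> = (\<Sum>i<n. \<mu> i y) * (e/2)" by (simp only: sum_distrib_right)
      also have "\<dots> = e/2" using \<mu>1[OF y] by simp
      finally show ?thesis .
    qed
    define X where "X t = (\<Sum>i<n. t i *\<^sub>R x i)" for t
    define Z where "Z = {X t | t. \<forall>i<n. t i \<in> {0..1::real}}"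
    have "compact Z"
      unfolding Z_def X_def by (rule compact_combination_cube)
    \<comment> \<open>A Lipschitz constant of \<open>X\<close> with respect to the largest change of
      a weight; the summand 1 keeps it positive when every net point is zero or there are
      none.\<close>
    define B where "B = 1 + (\<Sum>i<n. norm (x i))"
    have B: "B > 0" unfolding B_def by (simp add: add_pos_nonneg sum_nonneg)
    have X_dist: "norm (X t - X t') \<le> d * B" if "\<forall>j<n. \<bar>t j - t' j\<bar> \<le> d" "d \<ge> 0" for t t' d
    proof -
      have "norm (X t - X t') = norm (\<Sum>i<n. (t i - t' i) *\<^sub>R x i)"
        by (simp add: X_def scaleR_left_diff_distrib sum_subtractf)
      also have "\<dots> \<le> (\<Sum>i<n. d * norm (x i))"
        using that by (intro sum_norm_le) (auto intro: mult_right_mono)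
      also have "\<dots> \<le> d * B"
        using that by (simp add: B_def sum_distrib_left algebra_simps)
      finally show ?thesis .
    qed
    \<comment> \<open>The map is read on weights and not on points: the net points may be linearly
      dependent, so a point does not determine its weights.\<close>
    define g where "g t i = \<mu> i (f (X t))" for t i
    have "\<exists>t. (\<forall>j<n. t j \<in> {0..1} \<and> \<bar>g t j - t j\<bar> \<le> e / (2 * B))"
    proof (rule approximate_fixed_point_cube)
      show "g t i \<in> {0..1}" if "i < n" for t i
        unfolding g_def using \<mu>le fC that by blast
      show "0 < e / (2 * B)" using e B by simp
      fix e' :: real assume e': "e' > 0"
      have unif: "\<exists>d>0. \<forall>z\<in>Z. \<forall>z'\<in>Z. dist z' z < d \<longrightarrow> dist (\<mu> i (f z')) (\<mu> i (f z)) < e'" for i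
      proof -
        have "continuous_on Z f"
          using cont continuous_on_subset by blast
        then have "continuous_on Z (\<lambda>z. m i (f z))" "continuous_on Z (\<lambda>z. M (f z))"
          unfolding M_def m_def by (intro continuous_intros; simp)+
        moreover have "M (f z) \<noteq> 0" for z
          using M0[OF fC, of z] by simp
        ultimately have "continuous_on Z (\<lambda>z. \<mu> i (f z))"
          unfolding \<mu>_def by (intro continuous_on_divide) auto
        from compact_uniformly_continuous[OF this \<open>compact Z\<close>]
        show ?thesis unfolding uniformly_continuous_on_def using e' by blast
      qed
      then obtain dd where dd: "\<And>i. dd i > 0"
        "\<And>i z z'. z \<in> Z \<Longrightarrow> z' \<in> Z \<Longrightarrow> dist z' z < dd i \<Longrightarrow> dist (\<mu> i (f z')) (\<mu> i (f z)) < e'"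
        by metis
      \<comment> \<open>The inserted 1 keeps the set nonempty for \<open>n = 0\<close>.\<close>
      define d where "d = Min (insert 1 (dd ` {..<n}))"
      have d: "d > 0" "\<And>i. i < n \<Longrightarrow> d \<le> dd i"
        unfolding d_def using dd(1) by auto
      show "\<exists>d>0. \<forall>t t'. (\<forall>j<n. t j \<in> {0..1} \<and> t' j \<in> {0..1} \<and> \<bar>t j - t' j\<bar> \<le> d)
                  \<longrightarrow> (\<forall>i<n. \<bar>g t i - g t' i\<bar> \<le> e')"
      proof (intro exI[of _ "d / (2 * B)"] conjI allI impI)
        show "0 < d / (2 * B)" using d B by simp
        fix t t' i
        assume tt: "\<forall>j<n. t j \<in> {0..1} \<and> t' j \<in> {0..1} \<and> \<bar>t j - t' j\<bar> \<le> d / (2 * B)" and i: "i < n"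
        have "norm (X t - X t') \<le> d / (2 * B) * B"
          by (rule X_dist) (use tt d B in auto)
        also have "\<dots> < d" using B d by simp
        finally have "dist (X t) (X t') < dd i" using d(2)[OF i] by (simp add: dist_norm)
        moreover have "X t \<in> Z" "X t' \<in> Z" using tt by (auto simp: Z_def)
        ultimately have "dist (\<mu> i (f (X t))) (\<mu> i (f (X t'))) < e'"
          using dd(2) by blast
        then show "\<bar>g t i - g t' i\<bar> \<le> e'" by (simp add: g_def dist_real_def)
      qed
    qed
    then obtain t where t: "\<forall>j<n. t j \<in> {0..1} \<and> \<bar>g t j - t j\<bar> \<le> e / (2 * B)" by blast
    have "norm (X t - X (g t)) \<le> e / (2 * B) * B"
      by (rule X_dist) (use t e B in \<open>auto simp: abs_minus_commute\<close>)
    then have "norm (X t - X (g t)) \<le> e / 2" using B by simp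
    moreover have "norm (X (g t) - f (X t)) \<le> e / 2"
      using proj[OF fC] by (simp add: X_def g_def)
    ultimately have "norm (X t - f (X t)) \<le> e"
      using norm_triangle_ineq[of "X t - X (g t)" "X (g t) - f (X t)"] by simp
    then show ?thesis by blast
  qed
  then have "\<exists>x. norm (x - f x) \<le> 1 / real (Suc n)" for n
    by simp
  then obtain x where x: "\<And>n. norm (x n - f (x n)) \<le> 1 / real (Suc n)"
    by metis
  obtain l r where l: "strict_mono (r :: nat \<Rightarrow> nat)" "(\<lambda>n. f (x (r n))) \<longlonglongrightarrow> l"
    using compact_convergent_subseq[OF C, of "\<lambda>n. f (x n)"] fC by metis
  have "(\<lambda>n. x n - f (x n)) \<longlonglongrightarrow> 0"
    by (rule Lim_null_comparison[OF _ LIMSEQ_inverse_real_of_nat])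
      (use x in \<open>auto simp: inverse_eq_divide\<close>)
  then have "(\<lambda>n. x (r n) - f (x (r n))) \<longlonglongrightarrow> 0"
    using LIMSEQ_subseq_LIMSEQ[OF _ l(1)] by (auto simp: o_def)
  from tendsto_add[OF this l(2)] have xl: "(\<lambda>n. x (r n)) \<longlonglongrightarrow> l" by simp
  have "isCont f l" using cont by (simp add: continuous_on_eq_continuous_at)
  then have "(\<lambda>n. f (x (r n))) \<longlonglongrightarrow> f l"
    using xl by (rule isCont_tendsto_compose)
  then have "f l = l" using l(2) LIMSEQ_unique by blast
  then show ?thesis by blast
qed

section \<open>Invertible and Fredholm operators\<close>

lemma GL_bounded_below:
  assumes "T \<in> GL"
  obtains c where "c > 0" "\<And>u. c * norm u \<le> norm (blinfun_apply T u)"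
proof -
  have bij: "bij (blinfun_apply T)" and bl: "bounded_linear (inv (blinfun_apply T))"
    using assms by (auto simp: GL_def)
  obtain K where K: "K > 0" "\<And>v. norm (inv (blinfun_apply T) v) \<le> norm v * K"
    using bounded_linear.pos_bounded[OF bl] by blast
  have "norm u \<le> norm (blinfun_apply T u) * K" for u
    using K(2)[of "blinfun_apply T u"] bij by (simp add: bij_is_inj)
  then show ?thesis
    using K(1) by (intro that[of "1 / K"]) (auto simp: field_simps)
qed

lemma GL_I:
  assumes bij: "bij (blinfun_apply T)" and c: "c > 0" "\<And>u. c * norm u \<le> norm (blinfun_apply T u)"
  shows "T \<in> GL"
proof -
  let ?S = "inv (blinfun_apply T)"
  have TS: "blinfun_apply T (?S v) = v" for v
    using bij by (simp add: bij_is_surj surj_f_inv_f)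
  have ST: "?S (blinfun_apply T u) = u" for u
    using bij by (simp add: bij_is_inj)
  have "bounded_linear ?S"
  proof (rule bounded_linear_intro)
    show "?S (x + y) = ?S x + ?S y" for x y
      by (metis ST TS blinfun.add_right)
    show "?S (r *\<^sub>R x) = r *\<^sub>R ?S x" for r x
      by (metis ST TS blinfun.scaleR_right)
    show "norm (?S x) \<le> norm x * (1 / c)" for x
      using c(2)[of "?S x"] c(1) TS by (simp add: field_simps)
  qed
  with bij show ?thesis by (simp add: GL_def)
qed

lemma GL_inverseI:
  assumes "\<And>u. blinfun_apply S (blinfun_apply T u) = u" "\<And>v. blinfun_apply T (blinfun_apply S v) = v"
  shows "T \<in> GL"
proof -
  have "bij (blinfun_apply T)"
    using assms by (intro o_bij[of "blinfun_apply S"]) (auto simp: o_def id_def)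
  moreover have "inv (blinfun_apply T) = blinfun_apply S"
    using assms by (intro inv_unique_comp) (auto simp: o_def id_def)
  ultimately show ?thesis
    by (simp add: GL_def blinfun.bounded_linear_right)
qed

lemma GL_apply_inv:
  assumes "T \<in> GL"
  shows "blinfun_apply T (inv (blinfun_apply T) v) = v" "inv (blinfun_apply T) (blinfun_apply T u) = u"
  using assms by (auto simp: GL_def bij_is_surj surj_f_inv_f bij_is_inj)

lemma GL_compose:
  assumes "S \<in> GL" "T \<in> GL"
  shows "S o\<^sub>L T \<in> GL"
proof -
  have eq: "blinfun_apply (S o\<^sub>L T) = blinfun_apply S \<circ> blinfun_apply T"
    by auto
  obtain c where c: "c > 0" "\<And>u. c * norm u \<le> norm (blinfun_apply S u)"
    using GL_bounded_below[OF assms(1)] by blast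
  obtain d where d: "d > 0" "\<And>u. d * norm u \<le> norm (blinfun_apply T u)"
    using GL_bounded_below[OF assms(2)] by blast
  show ?thesis
  proof (rule GL_I)
    show "bij (blinfun_apply (S o\<^sub>L T))"
      unfolding eq using assms by (auto simp: GL_def intro: bij_comp)
    show "c * d > 0" using c d by simp
    show "c * d * norm u \<le> norm (blinfun_apply (S o\<^sub>L T) u)" for u
    proof -
      have "c * (d * norm u) \<le> c * norm (blinfun_apply T u)"
        using d(2)[of u] c(1) by (intro mult_left_mono) auto
      also have "\<dots> \<le> norm (blinfun_apply S (blinfun_apply T u))" by (rule c(2))
      finally show ?thesis by (simp add: mult.assoc)
    qed
  qed
qed

lemma bounded_below_perturb:
  fixes S T :: "'u::real_normed_vector \<Rightarrow>\<^sub>L 'v::real_normed_vector"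
  assumes "\<And>u. c * norm u \<le> norm (blinfun_apply T u)" "norm (S - T) \<le> c / 2"
  shows "c / 2 * norm u \<le> norm (blinfun_apply S u)"
proof -
  have "norm (blinfun_apply T u) \<le> norm (blinfun_apply S u) + norm (blinfun_apply (S - T) u)"
    using norm_triangle_ineq4[of "blinfun_apply S u" "blinfun_apply (S - T) u"]
    by (simp add: blinfun.diff_left)
  also have "norm (blinfun_apply (S - T) u) \<le> c / 2 * norm u"
    using norm_blinfun[of "S - T" u] assms(2) by (meson mult_right_mono norm_ge_zero order_trans)
  finally show ?thesis using assms(1)[of u] by (simp add: field_simps)
qed

text \<open>Within half the lower bound of \<open>T\<close>, an operator \<open>S\<close> keeps a
  lower bound, hence injectivity and a bounded inverse once it is onto. For surjectivity,
  \<open>S u = v\<close> is rewritten as \<open>u\<close> being the preimage under \<open>T\<close>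
  of \<open>v - (S - T) u\<close>, a contraction with factor 1/2.\<close>

lemma open_GL: "open (GL :: ('u::banach \<Rightarrow>\<^sub>L 'v::real_normed_vector) set)"
proof (unfold open_dist, intro ballI)
  fix T :: "'u \<Rightarrow>\<^sub>L 'v" assume T: "T \<in> GL"
  obtain c where c: "c > 0" "\<And>u. c * norm u \<le> norm (blinfun_apply T u)"
    using GL_bounded_below[OF T] by blast
  show "\<exists>e>0. \<forall>S. dist S T < e \<longrightarrow> S \<in> GL"
  proof (intro exI[of _ "c / 2"] conjI allI impI)
    show "0 < c / 2" using c by simp
    fix S assume "dist S T < c / 2"
    then have ST: "norm (S - T) \<le> c / 2" by (simp add: dist_norm)
    have below: "c / 2 * norm u \<le> norm (blinfun_apply S u)" for u
      by (rule bounded_below_perturb[OF c(2) ST])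
    show "S \<in> GL"
    proof (rule GL_I[OF _ _ below])
      have "inj (blinfun_apply S)"
      proof (rule injI)
        fix x y assume "blinfun_apply S x = blinfun_apply S y"
        then show "x = y"
          using below[of "x - y"] c(1) by (auto simp: blinfun.diff_right mult_le_0_iff)
      qed
      moreover have "surj (blinfun_apply S)"
      proof (unfold surj_def, intro allI)
        fix v
        let ?R = "inv (blinfun_apply T)"
        let ?g = "\<lambda>u. ?R (v - blinfun_apply (S - T) u)"
        have R: "linear ?R" using T by (simp add: GL_def bounded_linear.linear)
        have "\<exists>!u. ?g u = u"
        proof (rule banach_fix_type[of "1/2"])
          show "\<forall>x y. dist (?g x) (?g y) \<le> 1/2 * dist x y"
          proof (intro allI)
            fix x y
            have "?g x - ?g y = ?R (blinfun_apply (S - T) (y - x))"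
              by (simp add: linear_diff[OF R, symmetric] blinfun.diff_right)
            moreover have "c * norm (?R (blinfun_apply (S - T) (y - x))) \<le> norm (blinfun_apply (S - T) (y - x))"
              using c(2)[of "?R (blinfun_apply (S - T) (y - x))"] GL_apply_inv(1)[OF T] by simp
            moreover have "norm (blinfun_apply (S - T) (y - x)) \<le> c / 2 * norm (y - x)"
              using norm_blinfun[of "S - T" "y - x"] ST by (meson mult_right_mono norm_ge_zero order_trans)
            ultimately have "c * norm (?g x - ?g y) \<le> c * (1/2 * norm (x - y))"
              by (simp add: norm_minus_commute)
            then show "dist (?g x) (?g y) \<le> 1/2 * dist x y"
              using c(1) by (simp add: dist_norm)
          qed
        qed auto
        then obtain u where "?g u = u" by blast
        then have "blinfun_apply T u = v - blinfun_apply (S - T) u"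
          using GL_apply_inv(1)[OF T] by metis
        then show "\<exists>u. v = blinfun_apply S u"
          by (intro exI[of _ u]) (simp add: blinfun.diff_left)
      qed
      ultimately show "bij (blinfun_apply S)" by (simp add: bij_def)
      show "c / 2 > 0" using c by simp
    qed
  qed
qed

text \<open>Joint continuity needs a local bound on the inverses, which comes from the lower bound
  of \<open>M s\<close>: halved, it holds for all nearby \<open>t\<close>. Applied to the difference
  of the two preimages, \<open>M t\<close> gives \<open>v - w\<close> minus
  \<open>(M t - M s)\<close> of the preimage of \<open>w\<close> under \<open>M s\<close>, and this
  tends to 0.\<close>

lemma continuous_on_GL_inverse:
  fixes M :: "real \<Rightarrow> 'u::real_normed_vector \<Rightarrow>\<^sub>L 'v::real_normed_vector"
  assumes cont: "continuous_on J M" and GL: "\<And>t. t \<in> J \<Longrightarrow> M t \<in> GL"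
  shows "continuous_on (J \<times> UNIV) (\<lambda>(t, v). inv (blinfun_apply (M t)) v)"
proof (unfold continuous_on_def, intro ballI)
  fix p assume "p \<in> J \<times> (UNIV :: 'v set)"
  then obtain s w where p: "p = (s, w)" and s: "s \<in> J" by auto
  let ?A = "\<lambda>t v. inv (blinfun_apply (M t)) v"
  let ?F = "at (s, w) within J \<times> UNIV"
  obtain c where c: "c > 0" "\<And>u. c * norm u \<le> norm (blinfun_apply (M s) u)"
    using GL_bounded_below[OF GL[OF s]] by blast
  have Mt: "((\<lambda>p. M (fst p)) \<longlongrightarrow> M s) ?F"
  proof -
    have "continuous_on (J \<times> (UNIV::'v set)) (\<lambda>p. M (fst p))"
      by (rule continuous_on_compose2[OF cont]) (auto intro: continuous_intros)
    then show ?thesis using s unfolding continuous_on_def by fastforce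
  qed
  have sndt: "(snd \<longlongrightarrow> w) ?F"
    using tendsto_snd[OF tendsto_ident_at[of "(s, w)"]] by simp
  have ev: "eventually (\<lambda>p. norm (M (fst p) - M s) \<le> c / 2) ?F"
    using tendstoD[OF Mt, of "c/2"] c(1) by (auto simp: dist_norm elim!: eventually_mono)
  have inJ: "eventually (\<lambda>p. p \<in> J \<times> (UNIV::'v set)) ?F"
    by (simp add: eventually_at_filter)
  have bound: "eventually (\<lambda>p. norm (?A (fst p) (snd p) - ?A s w)
      \<le> 2 / c * (norm (snd p - w) + norm (M (fst p) - M s) * norm (?A s w))) ?F"
    using ev inJ
  proof eventually_elim
    case (elim p)
    let ?x = "?A (fst p) (snd p) - ?A s w"
    have t: "fst p \<in> J" using elim by auto
    have "c / 2 * norm ?x \<le> norm (blinfun_apply (M (fst p)) ?x)"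
      by (rule bounded_below_perturb[OF c(2) elim(1)])
    also have "blinfun_apply (M (fst p)) ?x = (snd p - w) - blinfun_apply (M (fst p) - M s) (?A s w)"
      using GL_apply_inv(1)[OF GL[OF t], of "snd p"] GL_apply_inv(1)[OF GL[OF s], of w]
      by (simp add: blinfun.diff_right blinfun.diff_left)
    also have "norm \<dots> \<le> norm (snd p - w) + norm (M (fst p) - M s) * norm (?A s w)"
      by (meson add_left_mono norm_blinfun norm_triangle_ineq4 order_trans)
    finally show ?case using c(1) by (simp add: field_simps)
  qed
  have "((\<lambda>p. 2 / c * (norm (snd p - w) + norm (M (fst p) - M s) * norm (?A s w)))
      \<longlongrightarrow> 2 / c * (norm (w - w) + norm (M s - M s) * norm (?A s w))) ?F"
    by (intro tendsto_intros Mt sndt)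
  then have lim0: "((\<lambda>p. 2 / c * (norm (snd p - w) + norm (M (fst p) - M s) * norm (?A s w))) \<longlongrightarrow> 0) ?F"
    by simp
  have "((\<lambda>p. ?A (fst p) (snd p) - ?A s w) \<longlongrightarrow> 0) ?F"
    by (rule Lim_null_comparison[OF bound lim0])
  then have "((\<lambda>p. ?A (fst p) (snd p)) \<longlongrightarrow> ?A s w) ?F"
    by (simp add: LIM_zero_iff)
  then show "((\<lambda>(t, v). ?A t v) \<longlongrightarrow> (\<lambda>(t, v). ?A t v) p) (at p within J \<times> UNIV)"
    by (simp add: p case_prod_beta')
qed

section \<open>Rank-one perturbations of the identity\<close>

definition rank_one :: "('u::real_normed_vector \<Rightarrow>\<^sub>L real) \<Rightarrow> 'v::real_normed_vector \<Rightarrow> ('u \<Rightarrow>\<^sub>L 'v)" where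
  "rank_one \<phi> w = blinfun_scaleR_left w o\<^sub>L \<phi>"

lemma rank_one_apply [simp]: "blinfun_apply (rank_one \<phi> w) u = blinfun_apply \<phi> u *\<^sub>R w"
  by (simp add: rank_one_def)

lemma continuous_on_rank_one [continuous_intros]:
  "continuous_on S f \<Longrightarrow> continuous_on S (\<lambda>x. rank_one \<phi> (f x))"
  unfolding rank_one_def
  by (intro bounded_bilinear.continuous_on[OF bounded_bilinear_blinfun_compose]
      bounded_linear.continuous_on[OF bounded_linear_blinfun_scaleR_left] continuous_on_const)

text \<open>Sherman-Morrison formula: the inverse is the identity plus \<open>k\<close> times the
  same rank-one operator, \<open>k\<close> being the reciprocal of
  \<open>1 - \<phi> w\<close>.\<close>

lemma id_minus_rank_one_GL:
  assumes "blinfun_apply \<phi> w \<noteq> 1"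
  shows "id_blinfun - rank_one \<phi> w \<in> GL"
proof -
  define k where "k = 1 / (1 - blinfun_apply \<phi> w)"
  have k: "k * (b - b * blinfun_apply \<phi> w) = b" "k * b * blinfun_apply \<phi> w = k * b - b" for b
    using assms by (auto simp: k_def field_simps)
  show ?thesis
  proof (rule GL_inverseI[of "id_blinfun + k *\<^sub>R rank_one \<phi> w"])
    fix u
    let ?b = "blinfun_apply \<phi> u"
    have plus: "blinfun_apply (id_blinfun + k *\<^sub>R rank_one \<phi> w) x = x + (k * blinfun_apply \<phi> x) *\<^sub>R w" for x
      by (simp add: blinfun.add_left blinfun.scaleR_left)
    have minus: "blinfun_apply (id_blinfun - rank_one \<phi> w) x = x - blinfun_apply \<phi> x *\<^sub>R w" for x
      by (simp add: blinfun.diff_left)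
    have "blinfun_apply (id_blinfun + k *\<^sub>R rank_one \<phi> w) (blinfun_apply (id_blinfun - rank_one \<phi> w) u)
        = (u - ?b *\<^sub>R w) + (k * (?b - ?b * blinfun_apply \<phi> w)) *\<^sub>R w"
      unfolding plus minus by (simp add: blinfun.diff_right blinfun.scaleR_right)
    also have "\<dots> = u" by (simp only: k(1)) simp
    finally show "blinfun_apply (id_blinfun + k *\<^sub>R rank_one \<phi> w) (blinfun_apply (id_blinfun - rank_one \<phi> w) u) = u" .
    have "blinfun_apply (id_blinfun - rank_one \<phi> w) (blinfun_apply (id_blinfun + k *\<^sub>R rank_one \<phi> w) u)
        = u + (k * ?b) *\<^sub>R w - (?b + k * ?b * blinfun_apply \<phi> w) *\<^sub>R w"
      unfolding plus minus by (simp add: blinfun.add_right blinfun.scaleR_right)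
    also have "\<dots> = u" by (simp only: k(2)) simp
    finally show "blinfun_apply (id_blinfun - rank_one \<phi> w) (blinfun_apply (id_blinfun + k *\<^sub>R rank_one \<phi> w) u) = u" .
  qed
qed

section \<open>Codimension and index zero\<close>

text \<open>The projection \<open>\<pi>\<close> onto \<open>W\<close> along \<open>S\<close> is
  injective on any other complement \<open>W'\<close>, so it carries a basis of \<open>W'\<close> to
  independent vectors of \<open>W\<close>.\<close>

lemma complementary_dim_le:
  assumes "complementary S W" "complementary S W'" "finite_dimensional W"
  shows "dim W' \<le> dim W"
proof -
  have S: "subspace S" "subspace W" "subspace W'" "S \<inter> W' = {0}" "S \<inter> W = {0}"
    using assms by (auto simp: complementary_def)
  have dec: "\<exists>s w. v = s + w \<and> s \<in> S \<and> w \<in> W" for v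
    using assms(1) unfolding complementary_def by blast
  obtain B where B: "finite B" "span B = W"
    using assms(3) by (auto simp: finite_dimensional_def)
  have "\<exists>w. v - w \<in> S \<and> w \<in> W" for v
    using dec[of v] by force
  then obtain \<pi> where \<pi>: "\<And>v. v - \<pi> v \<in> S" "\<And>v. \<pi> v \<in> W"
    by metis
  have uniq: "\<pi> v = w" if "v - w \<in> S" "w \<in> W" for v w
  proof -
    have "(v - w) - (v - \<pi> v) \<in> S" by (rule subspace_diff[OF S(1) that(1) \<pi>(1)])
    moreover have "\<pi> v - w \<in> W" using that \<pi>(2) S(2) by (intro subspace_diff)
    ultimately have "\<pi> v - w \<in> S \<inter> W" by simp
    then show ?thesis unfolding S(5) by simp
  qed
  have "linear \<pi>"
  proof (rule linearI)
    fix x y r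
    have "(x - \<pi> x) + (y - \<pi> y) \<in> S" using \<pi>(1) S(1) by (intro subspace_add)
    then have "x + y - (\<pi> x + \<pi> y) \<in> S" by (simp add: algebra_simps)
    then show "\<pi> (x + y) = \<pi> x + \<pi> y"
      using \<pi>(2) S(2) by (intro uniq) (simp_all add: subspace_add)
    have "r *\<^sub>R (x - \<pi> x) \<in> S" using \<pi>(1) S(1) by (intro subspace_scale)
    then show "\<pi> (r *\<^sub>R x) = r *\<^sub>R \<pi> x"
      using \<pi>(2) S(2) by (intro uniq) (simp_all add: subspace_scale scaleR_diff_right)
  qed
  have inj: "inj_on \<pi> W'"
  proof (rule inj_onI)
    fix x y assume xy: "x \<in> W'" "y \<in> W'" "\<pi> x = \<pi> y"
    have "(x - \<pi> x) - (y - \<pi> y) \<in> S" by (rule subspace_diff[OF S(1) \<pi>(1) \<pi>(1)])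
    then have "x - y \<in> S" using xy(3) by simp
    moreover have "x - y \<in> W'" using xy S(3) by (simp add: subspace_diff)
    ultimately have "x - y \<in> S \<inter> W'" by simp
    then show "x = y" unfolding S(4) by simp
  qed
  obtain B' where B': "B' \<subseteq> W'" "independent B'" "W' \<subseteq> span B'" "card B' = dim W'"
    by (rule basis_exists)
  have spB: "span B' \<subseteq> W'" using B'(1) S(3) by (rule span_minimal)
  have "independent (\<pi> ` B')"
    using \<open>linear \<pi>\<close> B'(2) inj_on_subset[OF inj spB] by (rule linear_independent_injective_image)
  moreover have "\<pi> ` B' \<subseteq> W" using \<pi>(2) by auto
  obtain C where C: "C \<subseteq> W" "independent C" "W \<subseteq> span C" "card C = dim W"
    by (rule basis_exists)
  have "finite C" using independent_span_bound[OF B(1) C(2)] C(1) B(2) by simp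
  then have "card (\<pi> ` B') \<le> card C"
    using independent_span_bound[OF \<open>finite C\<close> calculation] \<open>\<pi> ` B' \<subseteq> W\<close> C(3) by blast
  moreover have "card (\<pi> ` B') = card B'"
    using inj B'(1) by (meson card_image inj_on_subset)
  ultimately show ?thesis using B' C by simp
qed

lemma codim_eqI:
  assumes "complementary S W" "finite_dimensional W"
  shows "codim S = dim W"
  unfolding codim_def
proof (rule the_equality)
  show "\<exists>W'. complementary S W' \<and> finite_dimensional W' \<and> dim W' = dim W"
    using assms by blast
  show "n = dim W" if "\<exists>W'. complementary S W' \<and> finite_dimensional W' \<and> dim W' = n" for n
    using that assms complementary_dim_le by (metis order_antisym)
qed

lemma finite_dimensional_span_singleton: "finite_dimensional (span {x})"
  unfolding finite_dimensional_def by blast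

lemma finite_dimensional_zero: "finite_dimensional {0}"
  unfolding finite_dimensional_def by (intro exI[of _ "{}"]) auto

lemma GL_subset_Fredholm0: "GL \<subseteq> Fredholm0"
proof
  fix T :: "'u::real_normed_vector \<Rightarrow>\<^sub>L 'v::real_normed_vector" assume T: "T \<in> GL"
  have rng: "range (blinfun_apply T) = UNIV" and inj: "inj (blinfun_apply T)"
    using T by (auto simp: GL_def bij_def)
  have null: "null_space T = {0}"
    using inj by (auto simp: null_space_def inj_def blinfun.zero_right)
  have comp: "complementary (UNIV :: 'v set) {0}"
    by (auto simp: complementary_def)
  have "codim (UNIV :: 'v set) = 0"
    using codim_eqI[OF comp finite_dimensional_zero] dim_span[of "{} :: 'v set"] dim_eq_card_independent[of "{} :: 'v set"]
    by (simp add: independent_empty)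
  then show "T \<in> Fredholm0"
    using exI[of "\<lambda>W. complementary UNIV W \<and> finite_dimensional W", OF conjI[OF comp finite_dimensional_zero]]
      finite_dimensional_zero dim_span[of "{} :: 'u set"] dim_eq_card_independent[of "{} :: 'u set"]
    by (auto simp: Fredholm0_def fredholm_def fredholm_index_def finite_codimensional_def rng null
        independent_empty)
qed

text \<open>In the singular case \<open>\<phi> w = 1\<close> the second factor is the projection
  onto the kernel of \<open>\<phi>\<close> along \<open>w\<close>. The product then has kernel
  spanned by \<open>w\<close>, and its range, the kernel of a bounded functional, is complemented by
  the line through \<open>B w\<close>. This keeps homotopies that move only \<open>B\<close> and
  \<open>w\<close> inside \<open>Fredholm0\<close>.\<close>

lemma GL_compose_rank_one_Fredholm0:
  fixes B :: "'u::real_normed_vector \<Rightarrow>\<^sub>L 'v::real_normed_vector"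
  assumes B: "B \<in> GL"
  shows "B o\<^sub>L (id_blinfun - rank_one \<phi> w) \<in> Fredholm0"
proof (cases "blinfun_apply \<phi> w = 1")
  case False
  then show ?thesis
    using GL_compose[OF B id_minus_rank_one_GL] GL_subset_Fredholm0 by blast
next
  case True
  let ?T = "B o\<^sub>L (id_blinfun - rank_one \<phi> w)"
  let ?R = "inv (blinfun_apply B)"
  have T: "blinfun_apply ?T u = blinfun_apply B (u - blinfun_apply \<phi> u *\<^sub>R w)" for u
    by (simp add: blinfun.diff_left)
  have BR: "blinfun_apply B (?R v) = v" "?R (blinfun_apply B u) = u" for u v
    using GL_apply_inv[OF B] by auto
  have R: "bounded_linear ?R" using B by (simp add: GL_def)
  have w0: "w \<noteq> 0" using True by auto
  have null: "null_space ?T = span {w}"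
  proof (intro equalityI subsetI)
    fix u assume "u \<in> null_space ?T"
    then have "blinfun_apply B (u - blinfun_apply \<phi> u *\<^sub>R w) = blinfun_apply B 0"
      using T[of u] by (simp add: null_space_def blinfun.zero_right)
    then have "u - blinfun_apply \<phi> u *\<^sub>R w = 0" using BR(2) by metis
    then show "u \<in> span {w}"
      by (metis eq_iff_diff_eq_0 span_base span_scale singletonI)
  next
    fix u assume "u \<in> span {w}"
    then obtain k where "u = k *\<^sub>R w" by (auto simp: span_singleton)
    then show "u \<in> null_space ?T"
      using True T[of u] by (simp add: null_space_def blinfun.scaleR_right blinfun.zero_right)
  qed
  have rng: "range (blinfun_apply ?T) = {v. blinfun_apply \<phi> (?R v) = 0}"
  proof (intro equalityI subsetI)
    fix v assume "v \<in> range (blinfun_apply ?T)"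
    then obtain u where "v = blinfun_apply ?T u" by blast
    then have "?R v = u - blinfun_apply \<phi> u *\<^sub>R w" by (simp only: T BR)
    then show "v \<in> {v. blinfun_apply \<phi> (?R v) = 0}"
      using True by (simp add: blinfun.diff_right blinfun.scaleR_right)
  next
    fix v assume "v \<in> {v. blinfun_apply \<phi> (?R v) = 0}"
    then have "blinfun_apply ?T (?R v) = v" by (simp add: blinfun.diff_left BR)
    then show "v \<in> range (blinfun_apply ?T)" by (metis rangeI)
  qed
  have bl: "bounded_linear (\<lambda>v. blinfun_apply \<phi> (?R v))"
    using R blinfun.bounded_linear_right by (rule bounded_linear_compose[rotated])
  have closed: "closed (range (blinfun_apply ?T))"
    unfolding rng by (intro closed_Collect_eq linear_continuous_on bl continuous_on_const)
  have comp: "complementary (range (blinfun_apply ?T)) (span {blinfun_apply B w})"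
    unfolding complementary_def
  proof (intro conjI)
    show "subspace (range (blinfun_apply ?T))"
      by (intro linear_subspace_image) (auto simp: blinfun.bounded_linear_right bounded_linear.linear)
    show "range (blinfun_apply ?T) \<inter> span {blinfun_apply B w} = {0}"
    proof (intro equalityI subsetI)
      fix v assume v: "v \<in> range (blinfun_apply ?T) \<inter> span {blinfun_apply B w}"
      then obtain k where k: "v = k *\<^sub>R blinfun_apply B w" by (auto simp: span_singleton)
      then have "?R v = k *\<^sub>R w" by (metis BR(2) blinfun.scaleR_right)
      then have "k = 0" using v True unfolding rng by (simp add: blinfun.scaleR_right)
      then show "v \<in> {0}" using k by simp
    qed (auto simp: span_zero intro: range_eqI[of _ _ 0] simp: blinfun.zero_right)
    show "{a + b | a b. a \<in> range (blinfun_apply ?T) \<and> b \<in> span {blinfun_apply B w}} = UNIV"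
    proof (intro equalityI subsetI)
      fix v :: 'v
      let ?k = "blinfun_apply \<phi> (?R v)"
      have "v = blinfun_apply ?T (?R v) + ?k *\<^sub>R blinfun_apply B w"
        by (simp add: blinfun.diff_left blinfun.diff_right blinfun.scaleR_right BR)
      then show "v \<in> {a + b | a b. a \<in> range (blinfun_apply ?T) \<and> b \<in> span {blinfun_apply B w}}"
        using span_base span_scale by fastforce
    qed auto
  qed auto
  have Bw: "blinfun_apply B w \<noteq> 0" using w0 BR(2) by (metis blinfun.zero_right)
  have "codim (range (blinfun_apply ?T)) = 1"
    using codim_eqI[OF comp finite_dimensional_span_singleton] Bw dim_eq_card_independent[of "{blinfun_apply B w}"]
    by simp
  moreover have "dim (null_space ?T) = 1"
    using null w0 dim_eq_card_independent[of "{w}"] by simp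
  moreover have "finite_codimensional (range (blinfun_apply ?T))"
    unfolding finite_codimensional_def using comp finite_dimensional_span_singleton by blast
  moreover have "finite_dimensional (null_space ?T)"
    unfolding null by (rule finite_dimensional_span_singleton)
  ultimately show ?thesis
    unfolding Fredholm0_def fredholm_def fredholm_index_def mem_Collect_eq
    using closed by simp
qed

text \<open>Index zero turns the one-dimensional kernel into a one-dimensional complement of the
  range; \<open>v\<^sub>1\<close> spans it.\<close>

lemma Fredholm0_simple_kernel:
  fixes T :: "'u::real_normed_vector \<Rightarrow>\<^sub>L 'v::real_normed_vector"
  assumes T: "T \<in> Fredholm0" and null: "null_space T = span {x}" and x: "x \<noteq> 0"
  obtains v\<^sub>1 where "v\<^sub>1 \<notin> range (blinfun_apply T)" "\<And>v. \<exists>u k. v = blinfun_apply T u + k *\<^sub>R v\<^sub>1"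
proof -
  obtain W where W: "complementary (range (blinfun_apply T)) W" "finite_dimensional W"
    using T by (auto simp: Fredholm0_def fredholm_def finite_codimensional_def)
  have "dim (null_space T) = 1"
    using null x dim_eq_card_independent[of "{x}"] by simp
  then have "dim W = 1"
    using T codim_eqI[OF W] by (simp add: Fredholm0_def fredholm_index_def)
  then obtain B where B: "B \<subseteq> W" "independent B" "W \<subseteq> span B" "card B = 1"
    using basis_exists[of W] by metis
  then obtain v\<^sub>1 where v1: "B = {v\<^sub>1}" by (auto simp: card_1_singleton_iff)
  have "v\<^sub>1 \<noteq> 0" using B(2) v1 by auto
  then have "v\<^sub>1 \<notin> range (blinfun_apply T)"
    using W(1) B(1) v1 by (auto simp: complementary_def)
  moreover have "\<exists>u k. v = blinfun_apply T u + k *\<^sub>R v\<^sub>1" for v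
  proof -
    have "v \<in> {a + b |a b. a \<in> range (blinfun_apply T) \<and> b \<in> W}"
      using W(1) by (simp add: complementary_def)
    then obtain u b where "v = blinfun_apply T u + b" "b \<in> W" by blast
    moreover have "b \<in> range (\<lambda>k. k *\<^sub>R v\<^sub>1)"
      using \<open>b \<in> W\<close> B(3) v1 by (auto simp: span_singleton)
    ultimately show ?thesis by blast
  qed
  ultimately show ?thesis using that by blast
qed

section \<open>Parity of an admissible curve\<close>

lemma real_analytic_curve_const: "real_analytic_curve S (\<lambda>t. K)"
  unfolding real_analytic_curve_def
proof (intro ballI)
  fix x assume "x \<in> S"
  have "(\<lambda>n. (y - x) ^ n *\<^sub>R (if n = 0 then K else 0)) sums K" for y
  proof -
    have "(\<lambda>n. (y - x) ^ n *\<^sub>R (if n = 0 then K else 0)) = (\<lambda>n. if n = 0 then K else 0)"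
      by auto
    then show ?thesis using sums_single[of 0 "\<lambda>_. K"] by simp
  qed
  then show "\<exists>r>0. \<exists>c. \<forall>y\<in>S. \<bar>y - x\<bar> < r \<longrightarrow> (\<lambda>n. (y - x) ^ n *\<^sub>R c n) sums K"
    by (intro exI[of _ 1] conjI exI[of _ "\<lambda>n. if n = 0 then K else 0"]) auto
qed

text \<open>A vector \<open>w\<close> with \<open>\<phi> w = 1\<close> is nonzero and annihilated by
  the second factor, so \<open>T\<close> would not be injective.\<close>

lemma rank_one_factor_nonzero:
  assumes "T = M o\<^sub>L (id_blinfun - rank_one \<phi> w)" "T \<in> GL"
  shows "1 - blinfun_apply \<phi> w \<noteq> 0"
proof
  assume "1 - blinfun_apply \<phi> w = 0"
  then have w: "blinfun_apply \<phi> w = 1" by simp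
  then have "blinfun_apply T w = blinfun_apply T 0"
    by (simp add: assms(1) blinfun.diff_left blinfun.zero_right)
  then have "w = 0"
    using assms(2) GL_apply_inv(2) by metis
  with w show False by (simp add: blinfun.zero_right)
qed

text \<open>If the two factors had the same sign, the curve could be deformed into a constant
  invertible one, whose total multiplicity is zero.\<close>

lemma odd_mult_imp_sign_change:
  fixes L M :: "real \<Rightarrow> 'u::real_normed_vector \<Rightarrow>\<^sub>L 'v::real_normed_vector"
  assumes ab: "a \<le> b" and adm: "admissible a b L"
    and M: "continuous_on {a..b} M" "\<And>t. t \<in> {a..b} \<Longrightarrow> M t \<in> GL"
    and w: "continuous_on {a..b} w"
    and LM: "\<And>t. t \<in> {a..b} \<Longrightarrow> L t = M t o\<^sub>L (id_blinfun - rank_one \<phi> (w t))"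
    and e: "blinfun_apply \<phi> e = 1"
    and odd: "\<And>L\<^sub>\<omega>. real_analytic_curve {a..b} L\<^sub>\<omega> \<Longrightarrow> A_homotopic a b L\<^sub>\<omega> L \<Longrightarrow> odd (total_mult L\<^sub>\<omega> a b)"
  shows "(1 - blinfun_apply \<phi> (w a)) * (1 - blinfun_apply \<phi> (w b)) < 0"
proof (rule ccontr)
  let ?\<alpha> = "\<lambda>t. 1 - blinfun_apply \<phi> (w t)"
  assume "\<not> ?thesis"
  moreover have "?\<alpha> a \<noteq> 0" "?\<alpha> b \<noteq> 0"
    using rank_one_factor_nonzero[OF LM] adm ab by (auto simp: admissible_def)
  ultimately have pos: "?\<alpha> a * ?\<alpha> b > 0"
    by (metis linorder_neqE_linordered_idom mult_eq_0_iff)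
  \<comment> \<open>Chosen so that \<open>1 - \<phi> w\<^sub>0\<close> is 1 or -1, with the sign of
    \<alpha> at \<open>a\<close>; by assumption \<alpha> has this sign at \<open>b\<close>
    too.\<close>
  define w\<^sub>0 where "w\<^sub>0 = (if ?\<alpha> a > 0 then 0 else 2 *\<^sub>R e)"
  \<comment> \<open>For \<open>s = 1\<close> this is \<open>L\<close>. As \<open>s\<close> decreases
    to 0, the parameter of \<open>M\<close> contracts to \<open>a\<close> and \<open>w\<close> moves
    along a segment to \<open>w\<^sub>0\<close>, which leaves the constant curve
    \<open>K\<close>.\<close>
  define h where "h = (\<lambda>(s, t). M (a + s * (t - a)) o\<^sub>L (id_blinfun - rank_one \<phi> (s *\<^sub>R w t + (1 - s) *\<^sub>R w\<^sub>0)))"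
  have w0: "blinfun_apply \<phi> w\<^sub>0 = (if ?\<alpha> a > 0 then 0 else 2)"
    using e by (simp add: w\<^sub>0_def blinfun.scaleR_right blinfun.zero_right)
  have inab: "a + s * (t - a) \<in> {a..b}" if "s \<in> {0..1}" "t \<in> {a..b}" for s t
  proof -
    have "s * (t - a) \<le> 1 * (t - a)" using that by (intro mult_right_mono) auto
    then show ?thesis using that by auto
  qed
  have h_GL: "h (s, t) \<in> GL" if s: "s \<in> {0..1}" and t: "t = a \<or> t = b" for s t
  proof -
    let ?c = "1 - blinfun_apply \<phi> (s *\<^sub>R w t + (1 - s) *\<^sub>R w\<^sub>0)"
    \<comment> \<open>At an end point the factor is a convex combination of two numbers of the same
      sign, so invertibility persists there.\<close>
    have c: "?c = s * ?\<alpha> t + (1 - s) * (1 - blinfun_apply \<phi> w\<^sub>0)"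
      by (simp add: blinfun.add_right blinfun.scaleR_right) (simp add: algebra_simps)
    have "?c \<noteq> 0"
    proof (cases "?\<alpha> a > 0")
      case True
      then have "?\<alpha> t > 0" using pos t by (auto simp: zero_less_mult_iff)
      then have "s * ?\<alpha> t + (1 - s) > 0"
        using s by (cases "s = 0") (auto intro: add_pos_nonneg)
      then show ?thesis unfolding c w0 using True by simp
    next
      case False
      then have "?\<alpha> t < 0" using pos t by (auto simp: zero_less_mult_iff)
      then have "s * ?\<alpha> t + (1 - s) * (- 1) < 0"
        using s mult_pos_neg[of s "?\<alpha> t"] by (cases "s = 0") auto
      moreover have "1 - blinfun_apply \<phi> w\<^sub>0 = - 1" using w0 False by simp
      ultimately show ?thesis unfolding c by simp
    qed
    then have "id_blinfun - rank_one \<phi> (s *\<^sub>R w t + (1 - s) *\<^sub>R w\<^sub>0) \<in> GL"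
      by (intro id_minus_rank_one_GL) auto
    moreover have "M (a + s * (t - a)) \<in> GL"
      using M(2) inab[OF s, of t] t ab by auto
    ultimately show ?thesis unfolding h_def by (simp add: GL_compose)
  qed
  define K where "K = M a o\<^sub>L (id_blinfun - rank_one \<phi> w\<^sub>0)"
  have hK: "h (0, t) = K" for t by (simp add: h_def K_def)
  have h1: "h (1, t) = L t" if "t \<in> {a..b}" for t
    using LM[OF that] by (simp add: h_def)
  have K_GL: "K \<in> GL" using h_GL[of 0 a] hK by simp
  have cont_h: "continuous_on ({0..1} \<times> {a..b}) h"
  proof -
    have "continuous_on ({0..1} \<times> {a..b}) (\<lambda>p. M (a + fst p * (snd p - a)))"
      by (rule continuous_on_compose2[OF M(1)]) (use inab in \<open>auto intro!: continuous_intros\<close>)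
    moreover have "continuous_on ({0..1} \<times> {a..b}) (\<lambda>p. w (snd p))"
      by (rule continuous_on_compose2[OF w]) (auto intro!: continuous_intros)
    ultimately show ?thesis
      unfolding h_def case_prod_beta'
      by (intro bounded_bilinear.continuous_on[OF bounded_bilinear_blinfun_compose] continuous_intros)
  qed
  have h_F: "h ` ({0..1} \<times> {a..b}) \<subseteq> Fredholm0"
  proof clarify
    fix s t :: real assume "s \<in> {0..1}" "t \<in> {a..b}"
    then show "h (s, t) \<in> Fredholm0"
      unfolding h_def using GL_compose_rank_one_Fredholm0[OF M(2)[OF inab]] by simp
  qed
  have "homotopic_with_canon (\<lambda>p. p a \<in> GL \<and> p b \<in> GL) {a..b} Fredholm0 (\<lambda>t. K) L"
  proof (subst homotopic_with, goal_cases)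
    case (1 p q)
    then show ?case using ab by auto
  next
    case 2
    show ?case
    proof (intro exI[of _ h] conjI)
      show "continuous_map (prod_topology (top_of_set {0..1}) (top_of_set {a..b})) (top_of_set Fredholm0) h"
        using cont_h h_F by (auto simp: continuous_map_in_subtopology)
    qed (use hK h1 h_GL in auto)
  qed
  moreover have "admissible a b (\<lambda>t. K)"
    using K_GL GL_subset_Fredholm0 by (auto simp: admissible_def)
  ultimately have "A_homotopic a b (\<lambda>t. K) L"
    using adm by (simp add: A_homotopic_def)
  then have "odd (total_mult (\<lambda>t. K) a b)"
    using odd real_analytic_curve_const by blast
  moreover have "total_mult (\<lambda>t. K) a b = 0"
    using K_GL by (simp add: total_mult_def gen_spectrum_def)
  ultimately show False by simp
qed

lemma nonzero_same_sign:
  fixes f :: "real \<Rightarrow> real"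
  assumes "connected S" "continuous_on S f" "\<And>x. x \<in> S \<Longrightarrow> f x \<noteq> 0" "s \<in> S" "t \<in> S"
  shows "f s * f t > 0"
proof -
  have "connected (f ` S)" using assms by (intro connected_continuous_image)
  have "0 \<in> f ` S" if "f x \<le> 0" "0 \<le> f y" "x \<in> S" "y \<in> S" for x y
    using connectedD_interval[OF \<open>connected (f ` S)\<close>, of "f x" "f y" 0] that by auto
  then have "\<not> (f x \<le> 0 \<and> 0 \<le> f y)" if "x \<in> S" "y \<in> S" for x y
    using assms(3) that by force
  from this[of s t] this[of t s] show ?thesis
    using assms(4,5) by (auto simp: zero_less_mult_iff)
qed

text \<open>Any invertible \<open>M t\<close> of the form \<open>L t + rank_one \<phi> (y t)\<close>
  yields the factorization, with \<open>w t\<close> the preimage of \<open>y t\<close>; the point is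
  to choose \<open>y\<close> on the whole interval. Near \<open>l\<^sub>0\<close> the constant
  \<open>v\<^sub>1\<close> works because \<open>GL\<close> is open. Farther out \<open>L t\<close>
  is itself invertible, and \<open>y t = L t z\<close> with a fixed \<open>z\<close> makes
  \<open>M t\<close> the product of \<open>L t\<close> and the identity plus
  \<open>rank_one \<phi> z\<close>, invertible unless \<open>\<phi> z = -1\<close>. The choices
  agree at the junctions if \<open>L\<close> maps \<open>z\<close> to \<open>v\<^sub>1\<close>
  there.\<close>

lemma parametrix:
  fixes L :: "real \<Rightarrow> 'u::banach \<Rightarrow>\<^sub>L 'v::real_normed_vector"
  assumes contL: "continuous_on UNIV L" and FL: "\<And>t. L t \<in> Fredholm0"
    and d: "d > 0" and GL: "\<And>t. t \<in> {l\<^sub>0 - d..l\<^sub>0 + d} \<Longrightarrow> t \<noteq> l\<^sub>0 \<Longrightarrow> L t \<in> GL"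
    and v1: "L l\<^sub>0 + rank_one \<phi> v\<^sub>1 \<in> GL" and x: "blinfun_apply (L l\<^sub>0) x = 0" "blinfun_apply \<phi> x = 1"
    and odd: "\<forall>\<^sub>F \<rho> in at_right 0. \<forall>L\<^sub>\<omega>. real_analytic_curve {l\<^sub>0 - \<rho>..l\<^sub>0 + \<rho>} L\<^sub>\<omega> \<and>
           A_homotopic (l\<^sub>0 - \<rho>) (l\<^sub>0 + \<rho>) L\<^sub>\<omega> L \<longrightarrow> odd (total_mult L\<^sub>\<omega> (l\<^sub>0 - \<rho>) (l\<^sub>0 + \<rho>))"
  obtains M w \<sigma> where
    "continuous_on {l\<^sub>0 - d..l\<^sub>0 + d} M" "\<And>t. t \<in> {l\<^sub>0 - d..l\<^sub>0 + d} \<Longrightarrow> M t \<in> GL"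
    "continuous_on {l\<^sub>0 - d..l\<^sub>0 + d} w"
    "\<And>t. t \<in> {l\<^sub>0 - d..l\<^sub>0 + d} \<Longrightarrow> L t = M t o\<^sub>L (id_blinfun - rank_one \<phi> (w t))"
    "w l\<^sub>0 = x"
    "\<And>t. t \<in> {l\<^sub>0 - d..l\<^sub>0 + d} \<Longrightarrow> t > l\<^sub>0 \<Longrightarrow> \<sigma> * (1 - blinfun_apply \<phi> (w t)) > (0::real)"
    "\<And>t. t \<in> {l\<^sub>0 - d..l\<^sub>0 + d} \<Longrightarrow> t < l\<^sub>0 \<Longrightarrow> \<sigma> * (1 - blinfun_apply \<phi> (w t)) < 0"
proof -
  let ?J = "{l\<^sub>0 - d..l\<^sub>0 + d}"
  define T where "T t = L t + rank_one \<phi> v\<^sub>1" for t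
  have "continuous_on UNIV T"
    unfolding T_def by (intro continuous_intros contL)
  then have "open (T -` GL)"
    using open_GL by (auto simp: continuous_on_open_vimage)
  moreover have "l\<^sub>0 \<in> T -` GL" using v1 by (simp add: T_def)
  ultimately obtain r where r: "r > 0" "\<And>t. dist t l\<^sub>0 < r \<Longrightarrow> T t \<in> GL"
    unfolding open_dist by blast
  \<comment> \<open>The junctions are placed at a radius for which the oddness assumption holds as
    well, so that the sign change can be read off at the same two points.\<close>
  have "\<forall>\<^sub>F \<rho> in at_right 0. \<rho> \<in> {0<..<min r d}"
    using r(1) d by (intro eventually_at_right_real) auto
  from eventually_happens'[OF _ eventually_conj[OF odd this]]
  obtain \<rho> where \<rho>: "0 < \<rho>" "\<rho> < r" "\<rho> < d" and odd\<rho>: "\<And>L\<^sub>\<omega>. real_analytic_curve {l\<^sub>0 - \<rho>..l\<^sub>0 + \<rho>} L\<^sub>\<omega> \<Longrightarrow>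
           A_homotopic (l\<^sub>0 - \<rho>) (l\<^sub>0 + \<rho>) L\<^sub>\<omega> L \<Longrightarrow> odd (total_mult L\<^sub>\<omega> (l\<^sub>0 - \<rho>) (l\<^sub>0 + \<rho>))"
    by auto
  let ?a = "l\<^sub>0 - \<rho>" and ?b = "l\<^sub>0 + \<rho>"
  have TGL: "T t \<in> GL" if "t \<in> {?a..?b}" for t
    using r(2)[of t] that \<rho> by (auto simp: dist_real_def)
  have aGL: "L ?a \<in> GL" and bGL: "L ?b \<in> GL"
    using GL \<rho> by auto
  define z1 where "z1 = inv (blinfun_apply (L ?a)) v\<^sub>1"
  define z2 where "z2 = inv (blinfun_apply (L ?b)) v\<^sub>1"
  have z: "blinfun_apply (L ?a) z1 = v\<^sub>1" "blinfun_apply (L ?b) z2 = v\<^sub>1"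
    unfolding z1_def z2_def using GL_apply_inv(1) aGL bGL by blast+
  \<comment> \<open>Otherwise \<open>\<phi> z = -1\<close>, and \<open>T t z\<close> would be
    \<open>v\<^sub>1\<close> minus \<open>v\<^sub>1\<close>, although \<open>T t\<close> is
    injective and \<open>z\<close> is nonzero.\<close>
  have det: "blinfun_apply \<phi> (- z) \<noteq> 1" if "T t \<in> GL" "blinfun_apply (L t) z = v\<^sub>1" for t z
  proof
    assume 1: "blinfun_apply \<phi> (- z) = 1"
    then have "blinfun_apply (T t) z = blinfun_apply (T t) 0"
      using that(2) by (simp add: T_def blinfun.add_left blinfun.minus_right blinfun.zero_right)
    then have "z = 0" using that(1) GL_apply_inv(2) by metis
    then show False using 1 by (simp add: blinfun.zero_right)
  qed
  \<comment> \<open>The three pieces in one continuous expression: each difference vanishes until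
    \<open>t\<close> passes its junction, and beyond it the values of \<open>L\<close> at the
    junction cancel \<open>v\<^sub>1\<close>.\<close>
  define y where "y t = v\<^sub>1 + blinfun_apply (L (max t ?b) - L ?b) z2 + blinfun_apply (L (min t ?a) - L ?a) z1" for t
  define M where "M t = L t + rank_one \<phi> (y t)" for t
  have y1: "y t = v\<^sub>1" if "t \<in> {?a..?b}" for t
    using that by (auto simp: y_def max_def min_def blinfun.diff_left)
  have y2: "y t = blinfun_apply (L t) z2" if "t \<ge> ?b" for t
    using that \<rho> z by (auto simp: y_def max_def min_def blinfun.diff_left)
  have y3: "y t = blinfun_apply (L t) z1" if "t \<le> ?a" for t
    using that \<rho> z by (auto simp: y_def max_def min_def blinfun.diff_left)
  have conty: "continuous_on S y" for S
  proof -
    have "continuous_on S (\<lambda>t. L (max t ?b))" "continuous_on S (\<lambda>t. L (min t ?a))"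
      by (rule continuous_on_compose2[OF contL]; auto intro!: continuous_intros)+
    then show ?thesis
      unfolding y_def by (intro continuous_intros)
  qed
  have contM: "continuous_on S M" for S
    unfolding M_def by (intro continuous_intros conty continuous_on_subset[OF contL]) auto
  have MGL: "M t \<in> GL" if t: "t \<in> ?J" for t
  proof -
    have *: "M t \<in> GL" if "y t = blinfun_apply (L t) z" "blinfun_apply \<phi> (- z) \<noteq> 1" "t \<noteq> l\<^sub>0" for z
    proof -
      have "M t = L t o\<^sub>L (id_blinfun - rank_one \<phi> (- z))"
        by (rule blinfun_eqI) (simp add: M_def that(1) blinfun.add_left blinfun.diff_left
            blinfun.diff_right blinfun.add_right blinfun.minus_right blinfun.scaleR_right)
      then show ?thesis
        using GL_compose[OF GL[OF t that(3)] id_minus_rank_one_GL[OF that(2)]] by simp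
    qed
    consider "t \<in> {?a..?b}" | "t \<ge> ?b" | "t \<le> ?a" by fastforce
    then show ?thesis
    proof cases
      case 1
      then show ?thesis using TGL[OF 1] by (simp add: M_def T_def y1)
    next
      case 2
      then show ?thesis using *[OF y2[OF 2]] det[OF TGL z(2)] \<rho> by auto
    next
      case 3
      then show ?thesis using *[OF y3[OF 3]] det[OF TGL z(1)] \<rho> by auto
    qed
  qed
  define w where "w t = inv (blinfun_apply (M t)) (y t)" for t
  have contw: "continuous_on ?J w"
  proof -
    have "continuous_on ?J (\<lambda>t. (\<lambda>(t, v). inv (blinfun_apply (M t)) v) (t, y t))"
      by (rule continuous_on_compose2[OF continuous_on_GL_inverse[of ?J M]])
        (auto intro!: continuous_intros conty contM MGL)
    then show ?thesis by (simp add: w_def[abs_def])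
  qed
  have Mw: "blinfun_apply (M t) (w t) = y t" if "t \<in> ?J" for t
    unfolding w_def using GL_apply_inv(1) MGL[OF that] by blast
  have LM: "L t = M t o\<^sub>L (id_blinfun - rank_one \<phi> (w t))" if "t \<in> ?J" for t
  proof (rule blinfun_eqI)
    fix u
    have "blinfun_apply (M t) u = blinfun_apply (L t) u + blinfun_apply \<phi> u *\<^sub>R y t"
      by (simp add: M_def blinfun.add_left)
    then show "blinfun_apply (L t) u = blinfun_apply (M t o\<^sub>L (id_blinfun - rank_one \<phi> (w t))) u"
      using Mw[OF that] by (simp add: blinfun.diff_left blinfun.diff_right blinfun.scaleR_right)
  qed
  have wl: "w l\<^sub>0 = x"
  proof -
    have l: "l\<^sub>0 \<in> ?J" using d by simp
    have "blinfun_apply (M l\<^sub>0) x = y l\<^sub>0"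
      using x by (simp add: M_def blinfun.add_left)
    then show ?thesis unfolding w_def using GL_apply_inv(2)[OF MGL[OF l]] by metis
  qed
  let ?\<alpha> = "\<lambda>t. 1 - blinfun_apply \<phi> (w t)"
  have \<alpha>0: "?\<alpha> t \<noteq> 0" if "t \<in> ?J" "t \<noteq> l\<^sub>0" for t
    using rank_one_factor_nonzero[OF LM GL] that by auto
  have cont\<alpha>: "continuous_on ?J ?\<alpha>"
    by (intro continuous_intros contw)
  have sub: "{?a..?b} \<subseteq> ?J" using \<rho> by auto
  have chg: "?\<alpha> ?a * ?\<alpha> ?b < 0"
  proof (rule odd_mult_imp_sign_change[where M = M and L = L and e = x])
    show "?a \<le> ?b" using \<rho> by simp
    show "admissible ?a ?b L"
      using aGL bGL FL contL by (auto simp: admissible_def intro: continuous_on_subset)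
    show "continuous_on {?a..?b} w" using contw sub continuous_on_subset by blast
  qed (use contM MGL LM sub x odd\<rho> in auto)
  \<comment> \<open>\<alpha> vanishes in the interval only at \<open>l\<^sub>0\<close>, so its signs
    at the two junctions extend to each side by the intermediate value theorem. The value of
    \<alpha> at the right junction serves as \<open>\<sigma>\<close>.\<close>
  have right: "?\<alpha> t * ?\<alpha> ?b > 0" if "t \<in> ?J" "t > l\<^sub>0" for t
  proof (rule nonzero_same_sign[of "{l\<^sub>0<..l\<^sub>0 + d}" ?\<alpha> t ?b])
    show "continuous_on {l\<^sub>0<..l\<^sub>0 + d} ?\<alpha>"
      using cont\<alpha> by (rule continuous_on_subset) (use d in auto)
  qed (use that \<rho> d \<alpha>0 in auto)
  have left: "?\<alpha> t * ?\<alpha> ?a > 0" if "t \<in> ?J" "t < l\<^sub>0" for t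
  proof (rule nonzero_same_sign[of "{l\<^sub>0 - d..<l\<^sub>0}" ?\<alpha> t ?a])
    show "continuous_on {l\<^sub>0 - d..<l\<^sub>0} ?\<alpha>"
      using cont\<alpha> by (rule continuous_on_subset) (use d in auto)
  qed (use that \<rho> d \<alpha>0 in auto)
  show ?thesis
  proof (rule that[of M w "?\<alpha> ?b"])
    show "?\<alpha> ?b * ?\<alpha> t > 0" if "t \<in> ?J" "t > l\<^sub>0" for t
      using right[OF that] by (simp add: mult.commute)
    show "?\<alpha> ?b * ?\<alpha> t < 0" if "t \<in> ?J" "t < l\<^sub>0" for t
      using left[OF that] chg by (auto simp: zero_less_mult_iff mult_less_0_iff)
  qed (use contM MGL contw LM wl in auto)
qed

section \<open>Solution set near the trivial branch\<close>

text \<open>The last claim is a little-o estimate uniform in the parameter near \<open>s\<close>.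
  The derivative of \<open>nonlinear_part\<close> in \<open>u\<close> is the difference of
  \<open>F'\<close> at \<open>(t, u)\<close> and at \<open>(t, 0)\<close>, restricted to the second
  factor by \<open>j\<close>; it is small by continuity of \<open>F'\<close>, and the mean value
  inequality concludes.\<close>

lemma C1_map_linearization:
  fixes F :: "real \<times> 'u::real_normed_vector \<Rightarrow> 'v::real_normed_vector"
  assumes C1: "C1_map F" and F0: "\<And>t. F (t, 0) = 0"
  shows "continuous_on UNIV F" (is ?th1)
    and "continuous_on UNIV (linearization F)" (is ?th2)
    and "e > 0 \<Longrightarrow> \<exists>r>0. \<forall>t u. \<bar>t - s\<bar> < r \<and> norm u < r \<longrightarrow> norm (nonlinear_part F t u) \<le> e * norm u"
proof -
  obtain F' :: "real \<times> 'u \<Rightarrow> (real \<times> 'u) \<Rightarrow>\<^sub>L 'v"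
    where F': "\<And>x. (F has_derivative blinfun_apply (F' x)) (at x)" and contF': "continuous_on UNIV F'"
    using C1 by (auto simp: C1_map_def)
  show ?th1
    by (meson F' continuous_at_imp_continuous_on has_derivative_continuous)
  define j :: "'u \<Rightarrow>\<^sub>L (real \<times> 'u)" where "j = Blinfun (\<lambda>u. (0, u))"
  have j: "blinfun_apply j u = (0, u)" for u
    unfolding j_def by (subst bounded_linear_Blinfun_apply) (auto intro: bounded_linear_Pair bounded_linear_zero bounded_linear_ident)
  have dv: "((\<lambda>v. F (t, v)) has_derivative blinfun_apply (F' (t, u) o\<^sub>L j)) (at u)" for t u
  proof -
    have "((\<lambda>v. (t, v)) has_derivative (\<lambda>v. (0, v))) (at u)"
      by (intro has_derivative_Pair has_derivative_const has_derivative_ident)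
    from has_derivative_compose[OF this F'] show ?thesis
      by (rule has_derivative_eq_rhs) (simp add: j fun_eq_iff)
  qed
  have Du: "D\<^sub>u F t u = F' (t, u) o\<^sub>L j" for t u
    unfolding D\<^sub>u_def frechet_derivative_at[OF dv, symmetric] by (rule blinfun_apply_inverse)
  have L: "linearization F = (\<lambda>t. F' (t, 0) o\<^sub>L j)"
    by (simp add: linearization_def fun_eq_iff Du)
  show ?th2
    unfolding L
    by (intro bounded_bilinear.continuous_on[OF bounded_bilinear_blinfun_compose] continuous_on_const
        continuous_on_compose2[OF contF']) (auto intro!: continuous_intros)
  show "\<exists>r>0. \<forall>t u. \<bar>t - s\<bar> < r \<and> norm u < r \<longrightarrow> norm (nonlinear_part F t u) \<le> e * norm u" if e: "e > 0"
  proof -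
    have "isCont F' (s, 0)" using contF' by (simp add: continuous_on_eq_continuous_at)
    then obtain d where d: "d > 0" "\<And>x. dist x (s, 0) < d \<Longrightarrow> dist (F' x) (F' (s, 0)) < e / 2"
      unfolding continuous_at_eps_delta using e by (metis half_gt_zero)
    show ?thesis
    proof (intro exI[of _ "d / 2"] conjI allI impI)
      show "0 < d / 2" using d by simp
      fix t :: real and u :: 'u assume tu: "\<bar>t - s\<bar> < d / 2 \<and> norm u < d / 2"
      have near: "norm (F' (t, v) - F' (t, 0)) \<le> e" if "norm v < d / 2" for v
      proof -
        have ts: "dist (t, v) (s, 0) < d" if "norm v < d / 2" for v
          using norm_Pair_le[of "t - s" v] tu that by (auto simp: dist_norm)
        have "dist (F' (t, v)) (F' (s, 0)) < e / 2" "dist (F' (t, 0)) (F' (s, 0)) < e / 2"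
          using d(2)[OF ts[OF that]] d(2)[OF ts[of 0]] d(1) by simp_all
        then have "dist (F' (t, v)) (F' (t, 0)) < e" by (rule dist_triangle_half_l)
        then show ?thesis by (simp add: dist_norm)
      qed
      let ?g = "nonlinear_part F t"
      let ?D = "\<lambda>v. (F' (t, v) - F' (t, 0)) o\<^sub>L j"
      have der: "(?g has_derivative blinfun_apply (?D v)) (at v)" for v
        unfolding nonlinear_part_def L
        by (rule has_derivative_eq_rhs[OF has_derivative_diff[OF dv
              bounded_linear_imp_has_derivative[OF blinfun.bounded_linear_right]]])
          (simp add: fun_eq_iff blinfun.diff_left)
      have "norm (?g u - ?g 0) \<le> e * norm (u - 0)"
      proof (rule differentiable_bound[of "ball 0 (d/2)" _ "\<lambda>v. blinfun_apply (?D v)"])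
        show "onorm (blinfun_apply (?D v)) \<le> e" if "v \<in> ball 0 (d / 2)" for v
        proof (rule onorm_bound)
          show "0 \<le> e" using e by simp
          fix x
          have "norm (blinfun_apply (?D v) x) \<le> norm (F' (t, v) - F' (t, 0)) * norm (blinfun_apply j x)"
            by (simp add: norm_blinfun)
          also have "\<dots> \<le> e * norm x"
            using near[of v] that e by (intro mult_mono) (auto simp: j norm_Pair)
          finally show "norm (blinfun_apply (?D v) x) \<le> e * norm x" .
        qed
      qed (use der tu d in \<open>auto intro: has_derivative_at_withinI\<close>)
      then show "norm (?g u) \<le> e * norm u"
        by (simp add: nonlinear_part_def F0 blinfun.zero_right)
    qed
  qed
qed

lemma F_split: "F (t, u) = blinfun_apply (linearization F t) u + nonlinear_part F t u"
  by (simp add: nonlinear_part_def)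

text \<open>Around a trivial point with invertible linearization, a solution \<open>u\<close>
  satisfies \<open>c / 2 * norm u \<le> c / 4 * norm u\<close>: the left side is the perturbed lower
  bound of the linear part, the right side the little-o bound of the nonlinear one. So
  \<open>u = 0\<close>, and the nearby parameters are regular because \<open>GL\<close> is
  open.\<close>

lemma closed_nontrivial_solutions:
  fixes F :: "real \<times> 'u::banach \<Rightarrow> 'v::real_normed_vector"
  assumes C1: "C1_map F" and F0: "\<And>t. F (t, 0) = 0"
  shows "closed (nontrivial_solutions F)"
proof -
  let ?S = "nontrivial_solutions F" and ?L = "linearization F"
  note cont = C1_map_linearization[OF C1 F0]
  have "\<exists>e>0. \<forall>q. dist q p < e \<longrightarrow> q \<in> - ?S" if p: "p \<in> - ?S" for p
  proof (cases "F p = 0")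
    case False
    have "open {q. F q \<noteq> 0}"
      using cont(1) by (intro open_Collect_neq continuous_on_const) auto
    then obtain e where "e > 0" "\<And>q. dist q p < e \<Longrightarrow> F q \<noteq> 0"
      using False unfolding open_dist by blast
    moreover have "F q = 0" if "q \<in> ?S" for q
      using that F0 by (auto simp: nontrivial_solutions_def)
    ultimately show ?thesis by blast
  next
    case True
    then obtain t where t: "p = (t, 0)" "?L t \<in> GL"
      using p by (cases p) (auto simp: nontrivial_solutions_def trivial_branch_def gen_spectrum_def)
    obtain c where c: "c > 0" "\<And>u. c * norm u \<le> norm (blinfun_apply (?L t) u)"
      using GL_bounded_below[OF t(2)] by blast
    have "open (?L -` (GL \<inter> ball (?L t) (c / 2)))"
      using cont(2) open_GL by (auto simp: continuous_on_open_vimage)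
    moreover have "t \<in> ?L -` (GL \<inter> ball (?L t) (c / 2))"
      using t c by simp
    ultimately obtain e1 where e1: "e1 > 0"
      "\<And>s. dist s t < e1 \<Longrightarrow> s \<in> ?L -` (GL \<inter> ball (?L t) (c / 2))"
      unfolding open_dist by blast
    obtain e2 where e2: "e2 > 0"
      "\<And>s u. \<bar>s - t\<bar> < e2 \<Longrightarrow> norm u < e2 \<Longrightarrow> norm (nonlinear_part F s u) \<le> c / 4 * norm u"
      using cont(3)[of "c / 4" t] c(1) by auto
    show ?thesis
    proof (intro exI[of _ "min e1 e2"] conjI allI impI)
      show "0 < min e1 e2" using e1 e2 by simp
      fix q assume q: "dist q p < min e1 e2"
      obtain s u where su: "q = (s, u)" by (cases q)
      have "dist s t \<le> dist q p" "norm u \<le> dist q p"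
        using dist_fst_le[of q p] dist_snd_le[of q p] by (auto simp: su t dist_norm)
      then have s: "dist s t < e1" "\<bar>s - t\<bar> < e2" "norm u < e2"
        using q by (auto simp: dist_real_def)
      have GLs: "?L s \<in> GL" and Ls: "norm (?L s - ?L t) \<le> c / 2"
        using e1(2)[OF s(1)] by (auto simp: dist_norm norm_minus_commute)
      have "u = 0" if "F (s, u) = 0"
      proof -
        have "c / 2 * norm u \<le> norm (blinfun_apply (?L s) u)"
          by (rule bounded_below_perturb[OF c(2) Ls])
        moreover have "blinfun_apply (?L s) u = - nonlinear_part F s u"
          using that F_split[of F s u] by (simp add: eq_neg_iff_add_eq_0)
        ultimately have "c / 2 * norm u \<le> c / 4 * norm u"
          using e2(2)[OF s(2,3)] by simp
        then have "c * norm u \<le> 0" by simp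
        then show ?thesis using c(1) by (simp add: mult_le_0_iff)
      qed
      then show "q \<in> - ?S"
        using GLs by (auto simp: su nontrivial_solutions_def trivial_branch_def gen_spectrum_def)
    qed
  qed
  then have "open (- ?S)" unfolding open_dist by blast
  then show ?thesis by (simp add: closed_def)
qed

section \<open>Properness and invertibility at the eigenvalue\<close>

lemma proper_preimage_compact:
  assumes "proper_map (top_of_set K) euclidean F" "compact Q"
  shows "compact {x \<in> K. F x \<in> Q}"
  using compactin_proper_map_preimage[OF assms(1), of Q] assms(2)
  by (simp add: compactin_subtopology)

text \<open>The compact nonlinear part transfers properness from the map to its linearization.\<close>

lemma linearization_bounded_preimage_subseq:
  fixes F :: "real \<times> 'u::real_normed_vector \<Rightarrow> 'v::real_normed_vector"
  assumes \<iota>: "compact_inclusion \<iota>"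
    and F3: "\<And>K. closed K \<Longrightarrow> bounded K \<Longrightarrow> proper_map (top_of_set K) euclidean F"
    and N: "continuous_on UNIV N" "\<And>t u. N (t, \<iota> u) = nonlinear_part F t u"
    and u: "\<And>n. norm (u n) \<le> R" and lim: "(\<lambda>n. blinfun_apply (linearization F t) (u n)) \<longlonglongrightarrow> v"
  shows "\<exists>r x. strict_mono (r :: nat \<Rightarrow> nat) \<and> (\<lambda>n. u (r n)) \<longlonglongrightarrow> x"
proof -
  have cmp: "compact (closure (\<iota> ` cball 0 R))"
    using \<iota> by (simp add: compact_inclusion_def)
  have "\<iota> (u n) \<in> closure (\<iota> ` cball 0 R)" for n
    using u closure_subset by (force simp: dist_norm)
  then obtain y r where r: "strict_mono r" and y: "(\<lambda>n. \<iota> (u (r n))) \<longlonglongrightarrow> y"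
    using compact_convergent_subseq[OF cmp, of "\<lambda>n. \<iota> (u n)"] by metis
  have "isCont N (t, y)" using N(1) by (simp add: continuous_on_eq_continuous_at)
  then have "(\<lambda>n. N (t, \<iota> (u (r n)))) \<longlonglongrightarrow> N (t, y)"
    by (rule isCont_tendsto_compose) (intro tendsto_intros y)
  moreover have "(\<lambda>n. blinfun_apply (linearization F t) (u (r n))) \<longlonglongrightarrow> v"
    using LIMSEQ_subseq_LIMSEQ[OF lim r] by (simp add: o_def)
  ultimately have "(\<lambda>n. blinfun_apply (linearization F t) (u (r n)) + N (t, \<iota> (u (r n)))) \<longlonglongrightarrow> v + N (t, y)"
    by (intro tendsto_add)
  then have "(\<lambda>n. F (t, u (r n))) \<longlonglongrightarrow> v + N (t, y)"
    by (simp add: N(2) F_split[of F t])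
  \<comment> \<open>The values of \<open>F\<close> together with their limit form a compact set, to
    which properness on the closed bounded set \<open>{t} \<times> cball 0 R\<close>
    applies.\<close>
  then have Q: "compact (insert (v + N (t, y)) (range (\<lambda>n. F (t, u (r n)))))" (is "compact ?Q")
    using compactin_sequence_with_limit[of euclidean "\<lambda>n. F (t, u (r n))" "v + N (t, y)"] by simp
  have "compact {x \<in> {t} \<times> cball 0 R. F x \<in> ?Q}" (is "compact ?P")
    by (intro proper_preimage_compact F3 Q) (auto intro!: closed_Times bounded_Times)
  moreover have "(t, u (r n)) \<in> ?P" for n
    using u by (auto simp: dist_norm)
  ultimately obtain l q where "strict_mono q" "(\<lambda>n. (t, u (r (q n)))) \<longlonglongrightarrow> l"
    using compact_convergent_subseq[of ?P "\<lambda>n. (t, u (r n))"] by metis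
  then have "strict_mono (r \<circ> q)" "(\<lambda>n. u ((r \<circ> q) n)) \<longlonglongrightarrow> snd l"
    using r tendsto_snd by (auto intro: strict_mono_o dest: tendsto_snd)
  then show ?thesis by blast
qed

text \<open>Bijectivity is algebra: \<open>v\<^sub>1\<close> fills the missing direction of the
  range, and \<open>\<phi>\<close> detects the kernel. Without a lower bound there would be unit
  vectors with images tending to 0; along a subsequence \<open>\<phi>\<close> of them converges,
  hence so do their images under the linearization, and the preceding lemma produces a unit vector
  in the kernel.\<close>

lemma linearization_plus_rank_one_GL:
  fixes F :: "real \<times> 'u::real_normed_vector \<Rightarrow> 'v::real_normed_vector"
  assumes \<iota>: "compact_inclusion \<iota>"
    and F3: "\<And>K. closed K \<Longrightarrow> bounded K \<Longrightarrow> proper_map (top_of_set K) euclidean F"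
    and N: "continuous_on UNIV N" "\<And>t u. N (t, \<iota> u) = nonlinear_part F t u"
    and null: "null_space (linearization F t) = span {x}" and x: "blinfun_apply \<phi> x = 1"
    and v1: "v\<^sub>1 \<notin> range (blinfun_apply (linearization F t))"
      "\<And>v. \<exists>u k. v = blinfun_apply (linearization F t) u + k *\<^sub>R v\<^sub>1"
  shows "linearization F t + rank_one \<phi> v\<^sub>1 \<in> GL"
proof -
  let ?L = "linearization F t"
  let ?B = "?L + rank_one \<phi> v\<^sub>1"
  have B: "blinfun_apply ?B u = blinfun_apply ?L u + blinfun_apply \<phi> u *\<^sub>R v\<^sub>1" for u
    by (simp add: blinfun.add_left)
  have Lx: "blinfun_apply ?L x = 0"
    using null span_base[of x "{x}"] by (auto simp: null_space_def)
  have ker: "u = 0" if "blinfun_apply ?B u = 0" for u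
  proof -
    have eq: "blinfun_apply ?L u = - (blinfun_apply \<phi> u *\<^sub>R v\<^sub>1)"
      using that B by (simp add: eq_neg_iff_add_eq_0)
    have \<phi>u: "blinfun_apply \<phi> u = 0"
    proof (rule ccontr)
      assume ne: "blinfun_apply \<phi> u \<noteq> 0"
      have "blinfun_apply ?L ((- 1 / blinfun_apply \<phi> u) *\<^sub>R u) = v\<^sub>1"
        using ne by (simp only: blinfun.scaleR_right eq) simp
      then show False using v1(1) by (metis rangeI)
    qed
    then have "u \<in> span {x}" using eq null by (auto simp: null_space_def)
    then obtain k where "u = k *\<^sub>R x" by (auto simp: span_singleton)
    then show ?thesis using \<phi>u x by (simp add: blinfun.scaleR_right)
  qed
  have "inj (blinfun_apply ?B)"
  proof (rule injI)
    fix a b assume "blinfun_apply ?B a = blinfun_apply ?B b"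
    then have "blinfun_apply ?B (a - b) = 0" by (simp add: blinfun.diff_right)
    then show "a = b" using ker[of "a - b"] by simp
  qed
  moreover have "surj (blinfun_apply ?B)"
  proof (unfold surj_def, intro allI)
    fix v
    obtain u k where v: "v = blinfun_apply ?L u + k *\<^sub>R v\<^sub>1" using v1(2) by blast
    \<comment> \<open>Moving along the kernel vector \<open>x\<close> adjusts the value of
      \<open>\<phi>\<close> to \<open>k\<close> without changing the image under
      \<open>?L\<close>.\<close>
    have "v = blinfun_apply ?B (u + (k - blinfun_apply \<phi> u) *\<^sub>R x)"
      unfolding B by (simp add: blinfun.add_right blinfun.scaleR_right Lx x v)
    then show "\<exists>u. v = blinfun_apply ?B u" by blast
  qed
  ultimately have bij: "bij (blinfun_apply ?B)" by (simp add: bij_def)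
  have "\<exists>c>0. \<forall>u. c * norm u \<le> norm (blinfun_apply ?B u)"
  proof (rule ccontr)
    assume neg: "\<not> ?thesis"
    have "\<exists>u. norm u = 1 \<and> norm (blinfun_apply ?B u) \<le> 1 / real (Suc n)" for n
    proof -
      obtain u where u: "\<not> (1 / real (Suc n)) * norm u \<le> norm (blinfun_apply ?B u)"
        using neg by (metis of_nat_0_less_iff zero_less_Suc zero_less_divide_1_iff)
      then have "u \<noteq> 0" by auto
      have "norm (blinfun_apply ?B (sgn u)) = norm (blinfun_apply ?B u) / norm u"
        by (simp add: sgn_div_norm blinfun.scaleR_right divide_inverse mult.commute del: plus_blinfun.rep_eq)
      also have "\<dots> \<le> 1 / real (Suc n)"
        using u \<open>u \<noteq> 0\<close> by (simp add: field_simps)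
      finally show ?thesis using \<open>u \<noteq> 0\<close> by (intro exI[of _ "sgn u"]) (simp add: norm_sgn)
    qed
    then obtain u where u: "\<And>n. norm (u n) = 1" "\<And>n. norm (blinfun_apply ?B (u n)) \<le> 1 / real (Suc n)"
      by metis
    have B0: "(\<lambda>n. blinfun_apply ?B (u n)) \<longlonglongrightarrow> 0"
      by (rule Lim_null_comparison[OF _ LIMSEQ_inverse_real_of_nat])
        (use u(2) in \<open>auto simp: inverse_eq_divide\<close>)
    have "\<bar>blinfun_apply \<phi> (u n)\<bar> \<le> norm \<phi>" for n
      using norm_blinfun[of \<phi> "u n"] u(1) by simp
    then have "blinfun_apply \<phi> (u n) \<in> {- norm \<phi>..norm \<phi>}" for n
      by (simp add: abs_le_iff minus_le_iff)
    then obtain k r where r: "strict_mono r" and k: "(\<lambda>n. blinfun_apply \<phi> (u (r n))) \<longlonglongrightarrow> k"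
      using compact_convergent_subseq[of "{- norm \<phi>..norm \<phi>}" "\<lambda>n. blinfun_apply \<phi> (u n)"] compact_Icc by metis
    have B0r: "(\<lambda>n. blinfun_apply ?B (u (r n))) \<longlonglongrightarrow> 0"
      using LIMSEQ_subseq_LIMSEQ[OF B0 r] by (simp add: o_def)
    have "(\<lambda>n. blinfun_apply ?B (u (r n)) - blinfun_apply \<phi> (u (r n)) *\<^sub>R v\<^sub>1) \<longlonglongrightarrow> 0 - k *\<^sub>R v\<^sub>1"
      by (intro tendsto_intros B0r k)
    then have "(\<lambda>n. blinfun_apply ?L (u (r n))) \<longlonglongrightarrow> - k *\<^sub>R v\<^sub>1"
      by (simp add: B)
    with u(1) have "\<exists>q y. strict_mono (q :: nat \<Rightarrow> nat) \<and> (\<lambda>n. u (r (q n))) \<longlonglongrightarrow> y"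
      by (intro linearization_bounded_preimage_subseq[OF \<iota> F3 N, where R = 1]) auto
    then obtain q y where q: "strict_mono (q :: nat \<Rightarrow> nat)" "(\<lambda>n. u (r (q n))) \<longlonglongrightarrow> y"
      by blast
    have "(\<lambda>n. blinfun_apply ?B (u (r (q n)))) \<longlonglongrightarrow> blinfun_apply ?B y"
      by (intro tendsto_intros q)
    moreover have "(\<lambda>n. blinfun_apply ?B (u (r (q n)))) \<longlonglongrightarrow> 0"
      using LIMSEQ_subseq_LIMSEQ[OF B0r q(1)] by (simp add: o_def)
    ultimately have "blinfun_apply ?B y = 0" using LIMSEQ_unique by blast
    then have "y = 0" by (rule ker)
    moreover have "(\<lambda>n. norm (u (r (q n)))) \<longlonglongrightarrow> norm y" by (intro tendsto_intros q)
    then have "norm y = 1" using u(1) by (simp add: LIMSEQ_const_iff)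
    ultimately show False by simp
  qed
  then show ?thesis using GL_I[OF bij] by blast
qed

section \<open>Compactness of the rescaled nonlinearity\<close>

lemma compact_closure_of_convergent_subseqs:
  fixes A :: "'a::metric_space set"
  assumes "\<And>s. (\<And>n. s n \<in> A) \<Longrightarrow> \<exists>l r. strict_mono (r :: nat \<Rightarrow> nat) \<and> (\<lambda>n. s (r n)) \<longlonglongrightarrow> l"
  shows "compact (closure A)"
  unfolding compact_def
proof (intro allI impI)
  fix f :: "nat \<Rightarrow> 'a" assume f: "\<forall>n. f n \<in> closure A"
  have "\<exists>y\<in>A. dist y (f n) < 1 / real (Suc n)" for n
    using f by (simp add: closure_approachable)
  then obtain s where s: "\<And>n. s n \<in> A" "\<And>n. dist (s n) (f n) < 1 / real (Suc n)"
    by metis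
  obtain l r where r: "strict_mono (r :: nat \<Rightarrow> nat)" "(\<lambda>n. s (r n)) \<longlonglongrightarrow> l"
    using assms s(1) by metis
  have "(\<lambda>n. dist (s n) (f n)) \<longlonglongrightarrow> 0"
    by (rule Lim_null_comparison[OF _ LIMSEQ_inverse_real_of_nat])
      (use s(2) in \<open>auto simp: inverse_eq_divide intro!: always_eventually less_imp_le\<close>)
  then have "(\<lambda>n. dist (s (r n)) (f (r n))) \<longlonglongrightarrow> 0"
    using LIMSEQ_subseq_LIMSEQ[OF _ r(1), of "\<lambda>n. dist (s n) (f n)"] by (simp add: o_def)
  moreover have "(\<lambda>n. dist (s (r n)) l) \<longlonglongrightarrow> 0"
    by (rule tendsto_dist_iff[THEN iffD1, OF r(2)])
  ultimately have "(\<lambda>n. dist (s (r n)) (f (r n)) + dist (s (r n)) l) \<longlonglongrightarrow> 0 + 0"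
    by (rule tendsto_add)
  then have lim: "(\<lambda>n. dist (s (r n)) (f (r n)) + dist (s (r n)) l) \<longlonglongrightarrow> 0"
    by simp
  have "norm (dist (f (r n)) l) \<le> dist (s (r n)) (f (r n)) + dist (s (r n)) l" for n
    using dist_triangle3[of "f (r n)" l "s (r n)"] by simp
  then have "(\<lambda>n. dist (f (r n)) l) \<longlonglongrightarrow> 0"
    by (intro Lim_null_comparison[OF _ lim] always_eventually allI)
  then have "(\<lambda>n. f (r n)) \<longlonglongrightarrow> l"
    by (rule tendsto_dist_iff[THEN iffD2])
  moreover have "l \<in> closure A"
    using closure_sequential[of l A] r(2) s(1) by (metis)
  ultimately show "\<exists>l\<in>closure A. \<exists>r. strict_mono r \<and> (f \<circ> r) \<longlonglongrightarrow> l"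
    using r(1) by (auto simp: o_def)
qed

text \<open>The triples \<open>(t, s, \<iota> u)\<close> have a convergent subsequence. If the limit
  of \<open>s\<close> is positive, continuity of \<open>N\<close> on the larger space gives the
  limit of the quotients. If it is 0, the division spoils this argument, but the little-o estimate,
  uniform for bounded \<open>u\<close>, sends the quotients to 0.\<close>

lemma rescaled_nonlinear_part_compact:
  fixes F :: "real \<times> 'u::real_normed_vector \<Rightarrow> 'v::real_normed_vector"
  assumes C1: "C1_map F" and F0: "\<And>t. F (t, 0) = 0"
    and \<iota>: "compact_inclusion \<iota>"
    and N: "continuous_on UNIV N" "\<And>t u. N (t, \<iota> u) = nonlinear_part F t u"
    and J: "compact J"
  shows "compact (closure {nonlinear_part F t (s *\<^sub>R u) /\<^sub>R s | s t u. 0 < s \<and> s \<le> 1 \<and> t \<in> J \<and> norm u \<le> R})"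
    (is "compact (closure ?A)")
proof (rule compact_closure_of_convergent_subseqs)
  fix f :: "nat \<Rightarrow> 'v" assume "\<And>n. f n \<in> ?A"
  then have "\<forall>n. \<exists>s t u. f n = nonlinear_part F t (s *\<^sub>R u) /\<^sub>R s \<and> 0 < s \<and> s \<le> 1 \<and> t \<in> J \<and> norm u \<le> R"
    by blast
  then obtain s t u where f: "\<And>n. f n = nonlinear_part F (t n) (s n *\<^sub>R u n) /\<^sub>R s n"
    and s: "\<And>n. 0 < s n" "\<And>n. s n \<le> 1" and t: "\<And>n. t n \<in> J" and u: "\<And>n. norm (u n) \<le> R"
    by metis
  have lin: "linear \<iota>" using \<iota> by (simp add: compact_inclusion_def bounded_linear.linear)
  have "compact (closure (\<iota> ` cball 0 R))"
    using \<iota> by (simp add: compact_inclusion_def)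
  then have "compact (J \<times> {0..1::real} \<times> closure (\<iota> ` cball 0 R))"
    by (intro compact_Times J compact_Icc)
  moreover have "(t n, s n, \<iota> (u n)) \<in> J \<times> {0..1} \<times> closure (\<iota> ` cball 0 R)" for n
    using t s u closure_subset[of "\<iota> ` cball 0 R"] by (auto simp: less_imp_le)
  ultimately obtain l r where r: "strict_mono r" and l: "(\<lambda>n. (t (r n), s (r n), \<iota> (u (r n)))) \<longlonglongrightarrow> l"
    using compact_convergent_subseq[of "J \<times> {0..1} \<times> closure (\<iota> ` cball 0 R)" "\<lambda>n. (t n, s n, \<iota> (u n))"] by metis
  obtain t' s' y where l': "l = (t', s', y)" by (metis prod_cases3)
  have lt: "(\<lambda>n. t (r n)) \<longlonglongrightarrow> t'" and ls: "(\<lambda>n. s (r n)) \<longlonglongrightarrow> s'" and ly: "(\<lambda>n. \<iota> (u (r n))) \<longlonglongrightarrow> y"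
    using tendsto_fst[OF l] tendsto_fst[OF tendsto_snd[OF l]] tendsto_snd[OF tendsto_snd[OF l]]
    by (auto simp: l')
  have "\<exists>z. (\<lambda>n. f (r n)) \<longlonglongrightarrow> z"
  proof (cases "s' = 0")
    case False
    have "isCont N (t', s' *\<^sub>R y)" using N(1) by (simp add: continuous_on_eq_continuous_at)
    then have "(\<lambda>n. N (t (r n), s (r n) *\<^sub>R \<iota> (u (r n)))) \<longlonglongrightarrow> N (t', s' *\<^sub>R y)"
      by (rule isCont_tendsto_compose) (intro tendsto_intros lt ls ly)
    then have "(\<lambda>n. N (t (r n), s (r n) *\<^sub>R \<iota> (u (r n))) /\<^sub>R s (r n)) \<longlonglongrightarrow> N (t', s' *\<^sub>R y) /\<^sub>R s'"
      using False by (intro tendsto_intros ls)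
    moreover have "f (r n) = N (t (r n), s (r n) *\<^sub>R \<iota> (u (r n))) /\<^sub>R s (r n)" for n
      by (simp add: f N(2)[symmetric] linear_scale[OF lin])
    ultimately show ?thesis by auto
  next
    case True
    have "(\<lambda>n. f (r n)) \<longlonglongrightarrow> 0"
    proof (rule tendstoI)
      fix e :: real assume e: "e > 0"
      define B where "B = \<bar>R\<bar> + 1"
      have B: "B > 0" "norm (u n) < B" for n using u[of n] by (auto simp: B_def)
      obtain d where d: "d > 0"
        "\<And>t u. \<bar>t - t'\<bar> < d \<Longrightarrow> norm u < d \<Longrightarrow> norm (nonlinear_part F t u) \<le> e / B * norm u"
        using C1_map_linearization(3)[OF C1 F0, of "e / B" t'] e B by auto
      have "eventually (\<lambda>n. dist (t (r n)) t' < d) sequentially"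
        using tendstoD[OF lt d(1)] .
      moreover have "eventually (\<lambda>n. dist (s (r n)) s' < d / B) sequentially"
        using tendstoD[OF ls, of "d / B"] d B by simp
      ultimately show "eventually (\<lambda>n. dist (f (r n)) 0 < e) sequentially"
      proof eventually_elim
        case (elim n)
        let ?s = "s (r n)" and ?u = "u (r n)"
        have s0: "?s > 0" by (rule s)
        have "norm (?s *\<^sub>R ?u) = ?s * norm ?u" using s0 by simp
        also have "\<dots> \<le> ?s * B" using s0 B(2)[of "r n"] by (intro mult_left_mono) auto
        also have "\<dots> < d" using elim(2) True s0 B by (simp add: dist_real_def field_simps)
        finally have "norm (nonlinear_part F (t (r n)) (?s *\<^sub>R ?u)) \<le> e / B * norm (?s *\<^sub>R ?u)"
          using elim(1) by (intro d(2)) (auto simp: dist_real_def)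
        then have "norm (f (r n)) \<le> e / B * norm ?u"
          using s0 by (simp add: f field_simps)
        also have "\<dots> < e / B * B" using B e by (intro mult_strict_left_mono) auto
        finally show ?case using B by simp
      qed
    qed
    then show ?thesis by blast
  qed
  then show "\<exists>l r. strict_mono (r :: nat \<Rightarrow> nat) \<and> (\<lambda>n. f (r n)) \<longlonglongrightarrow> l"
    using r by blast
qed

section \<open>Unilateral continua\<close>

lemma compact_closed_positive_dist:
  fixes A B :: "'a::metric_space set"
  assumes "compact A" "closed B" "A \<inter> B = {}"
  obtains d where "d > 0" "\<And>x y. x \<in> A \<Longrightarrow> y \<in> B \<Longrightarrow> d \<le> dist x y"
proof (cases "A = {} \<or> B = {}")
  case True
  then show ?thesis using that[of 1] by auto
next
  case False
  have "continuous_on A (\<lambda>x. infdist x B)" by (intro continuous_intros)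
  then obtain a where a: "a \<in> A" "\<And>x. x \<in> A \<Longrightarrow> infdist a B \<le> infdist x B"
    using continuous_attains_inf[OF assms(1)] False by metis
  have "infdist a B > 0"
    using a(1) assms(2,3) False in_closed_iff_infdist_zero[of B a] infdist_nonneg[of a B] by force
  moreover have "infdist a B \<le> dist x y" if "x \<in> A" "y \<in> B" for x y
    using a(2)[OF that(1)] infdist_le[OF that(2), of x] by simp
  ultimately show ?thesis by (rule that)
qed

text \<open>Where \<open>s\<close> vanishes, the convention that division by 0 returns 0 supplies
  exactly the limit forced by the little-o estimate.\<close>

lemma continuous_on_rescaled_nonlinear_part:
  fixes F :: "real \<times> 'u::real_normed_vector \<Rightarrow> 'v::real_normed_vector"
  assumes C1: "C1_map F" and F0: "\<And>t. F (t, 0) = 0"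
    and s: "continuous_on UNIV s" "\<And>p. s p \<ge> 0"
  shows "continuous_on UNIV (\<lambda>p. nonlinear_part F (fst p) (s p *\<^sub>R snd p) /\<^sub>R s p)"
proof (rule continuous_at_imp_continuous_on, rule ballI)
  fix p :: "real \<times> 'u"
  let ?G = "\<lambda>p. nonlinear_part F (fst p) (s p *\<^sub>R snd p) /\<^sub>R s p"
  note cont = C1_map_linearization[OF C1 F0]
  show "isCont ?G p"
  proof (cases "s p = 0")
    case False
    have "open {q. s q \<noteq> 0}"
      using s(1) by (intro open_Collect_neq continuous_on_const) auto
    moreover have "continuous_on {q. s q \<noteq> 0} ?G"
    proof -
      have c: "continuous_on {q. s q \<noteq> 0} s" using s(1) continuous_on_subset by blast
      have "continuous_on {q. s q \<noteq> 0} (\<lambda>q. F (fst q, s q *\<^sub>R snd q))"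
        by (rule continuous_on_compose2[OF cont(1)]) (auto intro!: continuous_intros c)
      moreover have "continuous_on {q. s q \<noteq> 0} (\<lambda>q. linearization F (fst q))"
        by (rule continuous_on_compose2[OF cont(2)]) (auto intro!: continuous_intros)
      ultimately show ?thesis
        unfolding nonlinear_part_def using c by (intro continuous_intros) auto
    qed
    ultimately show ?thesis
      using False continuous_on_eq_continuous_at[of "{q. s q \<noteq> 0}" ?G] by blast
  next
    case True
    have "(?G \<longlongrightarrow> 0) (at p)"
    proof (rule tendstoI)
      fix e :: real assume e: "e > 0"
      define B where "B = norm (snd p) + 1"
      have B: "B > 0" by (simp add: B_def add_nonneg_pos)
      obtain d where d: "d > 0"
        "\<And>t u. \<bar>t - fst p\<bar> < d \<Longrightarrow> norm u < d \<Longrightarrow> norm (nonlinear_part F t u) \<le> e / B * norm u"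
        using cont(3)[of "e / B" "fst p"] e B by auto
      have sp: "(s \<longlongrightarrow> s p) (at p)"
        using s(1) by (metis UNIV_I continuous_on_def)
      have lu: "(snd \<longlongrightarrow> snd p) (at p)" and lt: "(fst \<longlongrightarrow> fst p) (at p)"
        by (auto intro: tendsto_intros)
      have "((\<lambda>q. s q *\<^sub>R snd q) \<longlongrightarrow> s p *\<^sub>R snd p) (at p)"
        by (intro tendsto_intros sp lu)
      from tendstoD[OF this d(1)] True
      have "eventually (\<lambda>q. norm (s q *\<^sub>R snd q) < d) (at p)" by simp
      moreover have "eventually (\<lambda>q. dist (fst q) (fst p) < d) (at p)"
        using tendstoD[OF lt d(1)] .
      moreover have "eventually (\<lambda>q. norm (snd q) < B) (at p)"
        using order_tendstoD(2)[OF tendsto_norm[OF lu], of B] by (simp add: B_def)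
      ultimately show "eventually (\<lambda>q. dist (?G q) 0 < e) (at p)"
      proof eventually_elim
        case (elim q)
        show ?case
        proof (cases "s q = 0")
          case False
          then have s0: "s q > 0" using s(2)[of q] by simp
          have "norm (nonlinear_part F (fst q) (s q *\<^sub>R snd q)) \<le> e / B * norm (s q *\<^sub>R snd q)"
            using elim by (intro d(2)) (auto simp: dist_real_def)
          then have "norm (?G q) \<le> e / B * norm (snd q)"
            using s0 by (simp add: field_simps)
          also have "\<dots> < e / B * B" using B e elim by (intro mult_strict_left_mono) auto
          finally show ?thesis using B by simp
        qed (use e in simp)
      qed
    qed
    then show ?thesis using True by (simp add: isCont_def)
  qed
qed

text \<open>The parameter of the fixed point problem is the value of \<open>\<phi>\<close>. A separation of the
  solution set makes it a function \<open>\<theta>\<close> of the unknown; the rescaled nonlinearity has solutions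
  outside the small ball only on rays through solutions inside the large one, where the cone
  condition applies.\<close>

lemma component_meets_sphere:
  fixes F :: "real \<times> 'u::banach \<Rightarrow> 'v::real_normed_vector"
  defines "S \<equiv> nontrivial_solutions F" and "L \<equiv> linearization F"
  assumes \<iota>: "compact_inclusion \<iota>"
    and C1: "C1_map F" and F0: "\<And>t. F (t, 0) = 0"
    and FL: "\<And>t. L t \<in> Fredholm0"
    and F3: "\<And>K. closed K \<Longrightarrow> bounded K \<Longrightarrow> proper_map (top_of_set K) euclidean F"
    and N: "continuous_on UNIV N" "\<And>t u. N (t, \<iota> u) = nonlinear_part F t u"
    and null: "null_space (L l\<^sub>0) = span {x}" and x: "norm x = 1" "blinfun_apply \<phi> x = 1"
    and spec: "l\<^sub>0 \<in> gen_spectrum L"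
    and odd: "\<forall>\<^sub>F \<rho> in at_right 0. \<forall>L\<^sub>\<omega>. real_analytic_curve {l\<^sub>0 - \<rho>..l\<^sub>0 + \<rho>} L\<^sub>\<omega> \<and>
           A_homotopic (l\<^sub>0 - \<rho>) (l\<^sub>0 + \<rho>) L\<^sub>\<omega> L \<longrightarrow> odd (total_mult L\<^sub>\<omega> (l\<^sub>0 - \<rho>) (l\<^sub>0 + \<rho>))"
    and c: "c > 0"
    and cone: "\<And>t u. (t, u) \<in> S \<Longrightarrow> (t, u) \<noteq> (l\<^sub>0, 0) \<Longrightarrow> (t, u) \<in> ball (l\<^sub>0, 0) \<delta> \<Longrightarrow>
       c * norm u < \<bar>blinfun_apply \<phi> u\<bar>"
    and d1: "0 < d1" "d1 < \<delta>"
  shows "connected_component_set (S \<inter> cball (l\<^sub>0, 0) d1 \<inter> {p. blinfun_apply \<phi> (snd p) \<ge> 0}) (l\<^sub>0, 0)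
      \<inter> sphere (l\<^sub>0, 0) d1 \<noteq> {}"
proof
  let ?p = "(l\<^sub>0, 0) :: real \<times> 'u"
  let ?\<phi> = "blinfun_apply \<phi>"
  define K where "K = S \<inter> cball ?p d1 \<inter> {p. ?\<phi> (snd p) \<ge> 0}"
  assume "connected_component_set (S \<inter> cball ?p d1 \<inter> {p. ?\<phi> (snd p) \<ge> 0}) ?p \<inter> sphere ?p d1 = {}"
  then have dis: "connected_component_set K ?p \<inter> sphere ?p d1 = {}" by (simp add: K_def)
  note cont = C1_map_linearization[OF C1 F0]
  have S0: "F q = 0" if "q \<in> S" for q
    using that F0 by (auto simp: S_def nontrivial_solutions_def)
  have SI: "(t, u) \<in> S" if "F (t, u) = 0" "u \<noteq> 0" for t u
    using that by (auto simp: S_def nontrivial_solutions_def trivial_branch_def)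
  have pS: "?p \<in> S"
    using spec by (auto simp: S_def L_def nontrivial_solutions_def)
  have closedS: "closed S"
    unfolding S_def by (rule closed_nontrivial_solutions[OF C1 F0])
  have clK: "closed K"
    unfolding K_def by (intro closed_Int closedS closed_cball closed_Collect_le continuous_intros)
  have "compact {q \<in> cball ?p d1. F q \<in> {0}}"
    by (intro proper_preimage_compact F3) auto
  moreover have "K = K \<inter> {q \<in> cball ?p d1. F q \<in> {0}}"
    using S0 by (auto simp: K_def)
  ultimately have cmpK: "compact K"
    using clK closed_Int_compact by metis
  have pK: "?p \<in> K" using pS d1 by (simp add: K_def blinfun.zero_right)
  have clsph: "closed (sphere ?p d1)"
    unfolding sphere_def by (intro closed_Collect_eq continuous_intros)
  obtain K1 K2 where K12: "compact K1" "compact K2" "K1 \<union> K2 = K" "K1 \<inter> K2 = {}" "?p \<in> K1"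
      "K \<inter> sphere ?p d1 \<subseteq> K2"
    using compact_component_separation[OF cmpK pK clsph dis] by metis
  have K1ball: "K1 \<subseteq> ball ?p d1"
  proof
    fix q assume "q \<in> K1"
    then have "q \<in> cball ?p d1" "q \<notin> sphere ?p d1"
      using K12 by (auto simp: K_def)
    then show "q \<in> ball ?p d1" by simp
  qed
  \<comment> \<open>The cutoff descends between \<open>d1\<close> and \<open>d2\<close>. Staying
    below \<open>\<delta>\<close> keeps the trivial points over \<open>?J\<close>, and all points
    where the cutoff is positive, in the ball of the cone condition.\<close>
  define d2 where "d2 = (d1 + \<delta>) / 2"
  have d2: "d1 < d2" "d2 < \<delta>" "d2 > 0" using d1 by (auto simp: d2_def)
  let ?J = "{l\<^sub>0 - d2..l\<^sub>0 + d2}"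
  have trivial: "(t, 0) \<notin> S" if "t \<in> ?J" "t \<noteq> l\<^sub>0" for t
  proof
    assume "(t, 0) \<in> S"
    moreover have "(t, 0) \<in> ball ?p \<delta>"
      using that d2 by (auto simp: dist_Pair_Pair dist_real_def)
    ultimately have "c * norm (0::'u) < \<bar>?\<phi> 0\<bar>" using cone that(2) by blast
    then show False by (simp add: blinfun.zero_right)
  qed
  have GLJ: "L t \<in> GL" if "t \<in> ?J" "t \<noteq> l\<^sub>0" for t
    using trivial[OF that] by (auto simp: S_def L_def nontrivial_solutions_def gen_spectrum_def)
  have x0: "x \<noteq> 0" using x by auto
  obtain v\<^sub>1 where v1: "v\<^sub>1 \<notin> range (blinfun_apply (L l\<^sub>0))" "\<And>v. \<exists>u k. v = blinfun_apply (L l\<^sub>0) u + k *\<^sub>R v\<^sub>1"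
    using Fredholm0_simple_kernel[OF FL null x0] by metis
  have BGL: "L l\<^sub>0 + rank_one \<phi> v\<^sub>1 \<in> GL"
    using linearization_plus_rank_one_GL[OF \<iota> F3 N, of l\<^sub>0 x \<phi> v\<^sub>1] null x(2) v1 by (simp add: L_def)
  have Lx: "blinfun_apply (L l\<^sub>0) x = 0"
    using null span_base[of x "{x}"] by (auto simp: null_space_def)
  have contL: "continuous_on UNIV L" unfolding L_def by (rule cont(2))
  obtain M w \<sigma> where contM: "continuous_on ?J M" and MGL: "\<And>t. t \<in> ?J \<Longrightarrow> M t \<in> GL"
    and contw: "continuous_on ?J w"
    and LM: "\<And>t. t \<in> ?J \<Longrightarrow> L t = M t o\<^sub>L (id_blinfun - rank_one \<phi> (w t))"
    and wl: "w l\<^sub>0 = x"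
    and right: "\<And>t. t \<in> ?J \<Longrightarrow> t > l\<^sub>0 \<Longrightarrow> \<sigma> * (1 - ?\<phi> (w t)) > (0::real)"
    and left: "\<And>t. t \<in> ?J \<Longrightarrow> t < l\<^sub>0 \<Longrightarrow> \<sigma> * (1 - ?\<phi> (w t)) < 0"
  proof (rule parametrix[OF contL FL d2(3) _ BGL Lx x(2) odd], goal_cases)
    case (1 t)
    show ?case by (rule GLJ[OF 1(2,3)])
  next
    case (2 M w \<sigma>)
    show ?case by (rule 2(1)[OF 2(2-8)])
  qed
  define A where "A t v = inv (blinfun_apply (M t)) v" for t v
  have contA: "continuous_on (?J \<times> UNIV) (\<lambda>(t, v). A t v)"
    unfolding A_def by (rule continuous_on_GL_inverse[OF contM MGL])
  have MA: "blinfun_apply (M t) (A t v) = v" if "t \<in> ?J" for t v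
    unfolding A_def using GL_apply_inv(1)[OF MGL[OF that]] .
  have A0: "A t 0 = 0" if "t \<in> ?J" for t
    unfolding A_def using GL_apply_inv(2)[OF MGL[OF that], of 0] by (simp add: blinfun.zero_right)

  \<comment> \<open>Too large for \<open>K1\<close>: it exceeds \<open>\<phi>\<close> on the ball of
    radius \<open>d1\<close>.\<close>
  define r1 where "r1 = norm \<phi> * d1 + 1"
  have r1: "?\<phi> u < r1" if "norm u \<le> d1" for u
  proof -
    have "\<bar>?\<phi> u\<bar> \<le> norm \<phi> * norm u" using norm_blinfun[of \<phi> u] by simp
    also have "\<dots> \<le> norm \<phi> * d1" using that by (intro mult_left_mono) auto
    finally show ?thesis by (simp add: r1_def)
  qed
  have K2pos: "?\<phi> (snd q) > 0" if q: "q \<in> K2" for q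
  proof -
    have "q \<in> K" "q \<noteq> ?p" using q K12 by auto
    then have "q \<in> S" "q \<in> ball ?p \<delta>" "?\<phi> (snd q) \<ge> 0"
      using d1 by (auto simp: K_def)
    then have "c * norm (snd q) < \<bar>?\<phi> (snd q)\<bar>"
      using cone[of "fst q" "snd q"] \<open>q \<noteq> ?p\<close> by simp
    moreover have "0 \<le> c * norm (snd q)" using c by simp
    ultimately show ?thesis using \<open>?\<phi> (snd q) \<ge> 0\<close> by linarith
  qed
  obtain m where m: "m > 0" "\<And>q. q \<in> K2 \<Longrightarrow> m \<le> ?\<phi> (snd q)"
  proof (cases "K2 = {}")
    case True
    then show ?thesis using that[of 1] by auto
  next
    case False
    have "continuous_on K2 (\<lambda>q. ?\<phi> (snd q))" by (intro continuous_intros)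
    then obtain q where "q \<in> K2" "\<forall>q'\<in>K2. ?\<phi> (snd q) \<le> ?\<phi> (snd q')"
      using continuous_attains_inf[OF K12(2) False] by metis
    then show ?thesis using that[of "?\<phi> (snd q)"] K2pos by auto
  qed
  \<comment> \<open>Trivial points with parameter away from \<open>l\<^sub>0\<close> form a compact
    set disjoint from the closed set \<open>S\<close>; so solutions over such parameters have norm
    at least \<open>m'\<close>.\<close>
  define T0 where "T0 = (\<lambda>t. (t, 0 :: 'u)) ` (?J \<inter> {t. \<bar>t - l\<^sub>0\<bar> \<ge> d1 / 2})"
  have "compact (?J \<inter> {t. \<bar>t - l\<^sub>0\<bar> \<ge> d1 / 2})"
    by (intro compact_Int_closed compact_Icc closed_Collect_le continuous_intros)
  then have "compact T0"
    unfolding T0_def by (intro compact_continuous_image continuous_intros)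
  moreover have "(t, 0) \<notin> S" if "t \<in> ?J" "\<bar>t - l\<^sub>0\<bar> \<ge> d1 / 2" for t
  proof (rule trivial[OF that(1)])
    show "t \<noteq> l\<^sub>0" using that(2) d1 by auto
  qed
  then have "T0 \<inter> S = {}"
    by (auto simp: T0_def simp del: atLeastAtMost_iff)
  ultimately obtain m' where m': "m' > 0" "\<And>q q'. q \<in> T0 \<Longrightarrow> q' \<in> S \<Longrightarrow> m' \<le> dist q q'"
    using compact_closed_positive_dist[OF _ closedS] by metis
  \<comment> \<open>Each bound excludes one kind of fixed point: \<open>m\<close> those in
    \<open>K2\<close>, \<open>d1\<close> the linear solution \<open>r0 *\<^sub>R x\<close>, and the
    multiple of \<open>c\<close> those of small norm away from \<open>l\<^sub>0\<close>. The bound 1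
    ensures \<open>r0 \<le> r1\<close>.\<close>
  define r0 where "r0 = min (min (m / 2) 1) (min (c * min (d1 / 2) m' / 2) (d1 / 2))"
  have r0: "r0 > 0" "r0 < m" "r0 \<le> 1" "r0 < d1"
    unfolding r0_def using m(1) m'(1) c d1 by auto
  have "r0 \<le> c * min (d1 / 2) m' / 2" unfolding r0_def by simp
  also have "\<dots> < c * min (d1 / 2) m'" using c d1 m' by simp
  finally have r0c: "r0 < c * min (d1 / 2) m'" .
  have r01: "r0 \<le> r1" using r0(3) d1 by (simp add: r1_def add_increasing)

  have "closed (K2 \<union> - ball ?p d1)" using K12(2) compact_imp_closed by (intro closed_Un) auto
  moreover have "(K2 \<union> - ball ?p d1) \<inter> K1 = {}" using K12(4) K1ball by auto
  ultimately obtain \<theta> where \<theta>: "continuous_on UNIV \<theta>" "\<And>q. \<theta> q \<in> {r0..r1}"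
    "\<And>q. q \<in> K2 \<union> - ball ?p d1 \<Longrightarrow> \<theta> q = r0" "\<And>q. q \<in> K1 \<Longrightarrow> \<theta> q = r1"
    using Urysohn_real_metric[OF _ compact_imp_closed[OF K12(1)] _ r01] by metis

  define s where "s q = max 0 (min 1 ((d2 - dist q ?p) / (d2 - d1)))" for q
  have conts: "continuous_on UNIV s"
    unfolding s_def using d2 by (intro continuous_intros) auto
  have s01: "0 \<le> s q" "s q \<le> 1" for q by (auto simp: s_def)
  have s1: "s q = 1" if "dist q ?p < d1" for q
    using that d2 by (simp add: s_def field_simps)
  have s_pos: "dist q ?p < d2" if "s q > 0" for q
    using that d2 by (auto simp: s_def zero_less_divide_iff split: if_splits simp: max_def min_def)
  define G where "G q = nonlinear_part F (fst q) (s q *\<^sub>R snd q) /\<^sub>R s q" for q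
  have contG: "continuous_on UNIV G"
    unfolding G_def by (rule continuous_on_rescaled_nonlinear_part[OF C1 F0 conts s01(1)])
  define R\<^sub>0 where "R\<^sub>0 = {nonlinear_part F t (s *\<^sub>R u) /\<^sub>R s | s t u. 0 < s \<and> s \<le> 1 \<and> t \<in> ?J \<and> norm u \<le> d2}"
  \<comment> \<open>The extra 0 is the value of \<open>G\<close> where the cutoff vanishes.\<close>
  define C\<^sub>0 where "C\<^sub>0 = insert 0 (closure R\<^sub>0)"
  have cmpC0: "compact C\<^sub>0"
    unfolding C\<^sub>0_def R\<^sub>0_def
    by (intro compact_insert rescaled_nonlinear_part_compact[OF C1 F0 \<iota> N] compact_Icc)
  have GC0: "G q \<in> C\<^sub>0" if "fst q \<in> ?J" for q
  proof (cases "s q = 0")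
    case False
    then have sq: "s q > 0" using s01(1)[of q] by simp
    have "norm (snd q) \<le> dist q ?p" using dist_snd_le[of q ?p] by simp
    then have "norm (snd q) \<le> d2" using s_pos[OF sq] by simp
    then have "G q \<in> R\<^sub>0"
      unfolding R\<^sub>0_def G_def mem_Collect_eq using sq s01(2)[of q] that
      by (intro exI[of _ "s q"] exI[of _ "fst q"] exI[of _ "snd q"] conjI refl)
    then show ?thesis unfolding C\<^sub>0_def using closure_subset[of R\<^sub>0] by auto
  qed (simp add: G_def C\<^sub>0_def)

  define \<kappa> where "\<kappa> t = max (l\<^sub>0 - d2) (min (l\<^sub>0 + d2) t)" for t
  have \<kappa>J: "\<kappa> t \<in> ?J" for t using d2 by (auto simp: \<kappa>_def)
  have cont\<kappa>: "continuous_on UNIV \<kappa>" unfolding \<kappa>_def by (intro continuous_intros)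
  define P where "P q = (\<kappa> (fst q), snd q)" for q :: "real \<times> 'u"
  define X where "X q = A (fst q) (G q)" for q
  define Y where "Y q = \<theta> q * (1 - ?\<phi> (w (fst q))) + ?\<phi> (X q)" for q
  \<comment> \<open>\<open>P\<close> moves the argument into the region where \<open>w\<close> and
    \<open>A\<close> are controlled, so the map is defined everywhere. The second component is the
    equation for \<open>u\<close> with \<open>r\<close> replaced by \<open>\<theta>\<close>; the
    first is the clamped step that encodes \<open>y = 0\<close>.\<close>
  define \<Theta> where "\<Theta> q = (\<kappa> (fst (P q) - \<sigma> * Y (P q)), \<theta> (P q) *\<^sub>R w (fst (P q)) - X (P q))" for q
  have contP: "continuous_on UNIV P"
    unfolding P_def by (intro continuous_intros continuous_on_compose2[OF cont\<kappa>]) auto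
  have PJ: "fst (P q) \<in> ?J" for q by (simp add: P_def \<kappa>J del: atLeastAtMost_iff)
  have cX: "continuous_on (?J \<times> UNIV) X"
  proof -
    have "continuous_on (?J \<times> UNIV) (\<lambda>q. (\<lambda>(t, v). A t v) (fst q, G q))"
      by (rule continuous_on_compose2[OF contA])
        (auto intro!: continuous_intros continuous_on_subset[OF contG])
    then show ?thesis by (simp add: X_def[abs_def])
  qed
  have cw: "continuous_on (?J \<times> (UNIV :: 'u set)) (\<lambda>q. w (fst q))"
    by (rule continuous_on_compose2[OF contw]) (auto intro!: continuous_intros)
  have c\<theta>: "continuous_on (?J \<times> UNIV) \<theta>" using \<theta>(1) continuous_on_subset by blast
  have PJ': "P ` UNIV \<subseteq> ?J \<times> UNIV" using \<kappa>J by (auto simp: P_def simp del: atLeastAtMost_iff)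
  have cY: "continuous_on (?J \<times> UNIV) Y"
    unfolding Y_def by (intro continuous_intros c\<theta> cw cX)
  have cB: "continuous_on (?J \<times> UNIV) (\<lambda>q. \<theta> q *\<^sub>R w (fst q) - X q)"
    by (intro continuous_intros c\<theta> cw cX)
  have cont\<Theta>: "continuous_on UNIV \<Theta>"
  proof -
    have 1: "continuous_on UNIV (\<lambda>q. Y (P q))"
      by (rule continuous_on_compose2[OF cY contP PJ'])
    have 2: "continuous_on UNIV (\<lambda>q. \<theta> (P q) *\<^sub>R w (fst (P q)) - X (P q))"
      by (rule continuous_on_compose2[OF cB contP PJ'])
    have "continuous_on UNIV (\<lambda>q. \<kappa> (fst (P q) - \<sigma> * Y (P q)))"
      by (rule continuous_on_compose2[OF cont\<kappa>]) (auto intro!: continuous_intros contP 1)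
    then show ?thesis unfolding \<Theta>_def using 2 by (rule continuous_on_Pair)
  qed
  define E where "E = (\<lambda>(r, t, v). r *\<^sub>R w t - A t v) ` ({r0..r1} \<times> ?J \<times> C\<^sub>0)"
  have "compact E"
    unfolding E_def
  proof (intro compact_continuous_image compact_Times compact_Icc cmpC0)
    have "continuous_on ({r0..r1} \<times> ?J \<times> C\<^sub>0) (\<lambda>z. w (fst (snd z)))"
      by (rule continuous_on_compose2[OF contw]) (auto intro!: continuous_intros)
    moreover have "continuous_on ({r0..r1} \<times> ?J \<times> C\<^sub>0) (\<lambda>z. (\<lambda>(t, v). A t v) (snd z))"
      by (rule continuous_on_compose2[OF contA]) (auto intro!: continuous_intros)
    ultimately have "continuous_on ({r0..r1} \<times> ?J \<times> C\<^sub>0)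
        (\<lambda>z. fst z *\<^sub>R w (fst (snd z)) - A (fst (snd z)) (snd (snd z)))"
      by (intro continuous_intros) (auto simp: case_prod_beta')
    then show "continuous_on ({r0..r1} \<times> ?J \<times> C\<^sub>0) (\<lambda>(r, t, v). r *\<^sub>R w t - A t v)"
      by (simp add: case_prod_beta')
  qed
  then have cmp: "compact (?J \<times> E)" by (intro compact_Times compact_Icc)
  have "\<Theta> q \<in> ?J \<times> E" for q
  proof -
    have "\<theta> (P q) *\<^sub>R w (fst (P q)) - X (P q) \<in> E"
      unfolding E_def X_def
      by (rule image_eqI[of _ _ "(\<theta> (P q), fst (P q), G (P q))"])
        (use \<theta>(2) PJ GC0 in \<open>auto simp del: atLeastAtMost_iff\<close>)
    then show ?thesis unfolding \<Theta>_def using \<kappa>J by blast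
  qed
  then obtain q where q: "\<Theta> q = q"
    using Schauder_fixed_point[OF cont\<Theta> cmp] by blast
  obtain t u where tu: "q = (t, u)" by (cases q)
  have t\<kappa>: "t = \<kappa> (fst (P q) - \<sigma> * Y (P q))" and u\<kappa>: "u = \<theta> (P q) *\<^sub>R w (fst (P q)) - X (P q)"
    using q by (auto simp: \<Theta>_def tu)
  have tJ: "t \<in> ?J" using t\<kappa> \<kappa>J by metis
  then have "\<kappa> t = t" by (auto simp: \<kappa>_def)
  then have Pq: "P q = (t, u)" by (simp add: P_def tu)
  define r where "r = \<theta> (t, u)"
  define g where "g = G (t, u)"
  define y where "y = Y (t, u)"
  define s' where "s' = s (t, u)"
  have r_pos: "r > 0" using \<theta>(2)[of "(t, u)"] r0 by (simp add: r_def)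
  have t_eq: "t = \<kappa> (t - \<sigma> * y)" using t\<kappa> by (simp add: Pq y_def)
  have u_eq: "u = r *\<^sub>R w t - A t g" using u\<kappa> by (simp add: Pq r_def g_def X_def)
  have y_eq: "y = r * (1 - ?\<phi> (w t)) + ?\<phi> (A t g)" by (simp add: y_def Y_def r_def g_def X_def)
  have g0: "g = 0" if "s' = 0" using that by (simp add: g_def G_def s'_def)
  have s'0: "s' = 0" if "\<bar>t - l\<^sub>0\<bar> \<ge> d2"
  proof (rule ccontr)
    assume "s' \<noteq> 0"
    then have "dist (t, u) ?p < d2" using s01(1)[of "(t, u)"] by (intro s_pos) (simp add: s'_def)
    moreover have "\<bar>t - l\<^sub>0\<bar> \<le> dist (t, u) ?p"
      using dist_fst_le[of "(t, u)" ?p] by (simp add: dist_real_def)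
    ultimately show False using that by simp
  qed
  have sy: "\<sigma> * y = r * (\<sigma> * (1 - ?\<phi> (w t)))" if "s' = 0"
    using that by (simp add: y_eq g0 A0[OF tJ] blinfun.zero_right)
  have \<sigma>0: "\<sigma> \<noteq> 0" using right[of "l\<^sub>0 + d2"] d2 by auto
  \<comment> \<open>Inside the interval the clamp is inactive near \<open>t\<close>, so the step
    must be zero. At an end the cutoff vanishes and \<open>\<sigma> * y\<close> has the sign of
    \<open>t - l\<^sub>0\<close>: the step would move \<open>t\<close> strictly inwards.\<close>
  have "y = 0"
  proof -
    consider "l\<^sub>0 - d2 < t" "t < l\<^sub>0 + d2" | "t = l\<^sub>0 + d2" | "t = l\<^sub>0 - d2" using tJ by fastforce
    then have "\<sigma> * y = 0"
    proof cases
      case 1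
      then show ?thesis using t_eq by (auto simp: \<kappa>_def max_def min_def split: if_splits)
    next
      case 2
      then have z: "s' = 0" using d2 by (intro s'0) simp
      have "\<sigma> * (1 - ?\<phi> (w t)) > 0" using right[OF tJ] 2 d2 by simp
      then have "\<sigma> * y > 0" unfolding sy[OF z] by (rule mult_pos_pos[OF r_pos])
      then show ?thesis using t_eq 2 d2 by (auto simp: \<kappa>_def max_def min_def split: if_splits)
    next
      case 3
      then have z: "s' = 0" using d2 by (intro s'0) simp
      have "\<sigma> * (1 - ?\<phi> (w t)) < 0" using left[OF tJ] 3 d2 by simp
      then have "\<sigma> * y < 0" unfolding sy[OF z] by (rule mult_pos_neg[OF r_pos])
      then show ?thesis using t_eq 3 d2 by (auto simp: \<kappa>_def max_def min_def split: if_splits)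
    qed
    then show ?thesis using \<sigma>0 by simp
  qed
  have \<phi>u: "?\<phi> u = r"
  proof -
    have "?\<phi> u = r * ?\<phi> (w t) - ?\<phi> (A t g)"
      by (subst u_eq) (simp add: blinfun.diff_right blinfun.scaleR_right)
    also have "\<dots> = r - y" by (simp add: y_eq algebra_simps)
    finally show ?thesis using \<open>y = 0\<close> by simp
  qed
  then have u0: "u \<noteq> 0" using r_pos by (auto simp: blinfun.zero_right)
  have Lu: "blinfun_apply (L t) u + g = 0"
  proof -
    have "blinfun_apply (L t) u = blinfun_apply (M t) (u - r *\<^sub>R w t)"
      by (simp add: LM[OF tJ] blinfun.diff_left \<phi>u)
    also have "u - r *\<^sub>R w t = - A t g" by (subst u_eq) simp
    finally show ?thesis by (simp add: blinfun.minus_right MA[OF tJ])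
  qed
  have sol: "(t, s' *\<^sub>R u) \<in> S" if "s' > 0"
  proof (rule SI)
    have "s' *\<^sub>R g = nonlinear_part F t (s' *\<^sub>R u)"
      using that by (simp add: g_def G_def s'_def)
    moreover have "s' *\<^sub>R (blinfun_apply (L t) u + g) = 0" using Lu by simp
    ultimately show "F (t, s' *\<^sub>R u) = 0"
      using F_split[of F t "s' *\<^sub>R u"] by (simp add: L_def scaleR_add_right blinfun.scaleR_right)
  qed (use that u0 in simp)
  \<comment> \<open>The cone inequality holds at the genuine solution \<open>s' *\<^sub>R u\<close>,
    which is no farther from \<open>?p\<close> than \<open>(t, u)\<close>; dividing by
    \<open>s'\<close> gives it for \<open>u\<close>.\<close>
  have small: "c * norm u < r" if s': "s' > 0"
  proof -
    have "dist (t, s' *\<^sub>R u) ?p \<le> dist (t, u) ?p"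
    proof -
      have "norm (s' *\<^sub>R u) \<le> norm u"
        using s' s01(2)[of "(t, u)"] mult_right_mono[of s' 1 "norm u"] by (simp add: s'_def)
      then have "(norm (s' *\<^sub>R u))\<^sup>2 \<le> (norm u)\<^sup>2" by (intro power_mono) auto
      then show ?thesis unfolding dist_Pair_Pair by (intro real_sqrt_le_mono) simp
    qed
    then have "(t, s' *\<^sub>R u) \<in> ball ?p \<delta>"
      using s_pos[of "(t, u)"] s' d2 by (simp add: dist_commute s'_def)
    moreover have "(t, s' *\<^sub>R u) \<noteq> ?p" using s' u0 by simp
    ultimately have "c * norm (s' *\<^sub>R u) < \<bar>?\<phi> (s' *\<^sub>R u)\<bar>" using cone sol[OF s'] by blast
    then have "s' * (c * norm u) < s' * r"
      using s' r_pos \<phi>u by (simp add: blinfun.scaleR_right abs_mult mult_ac)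
    then show ?thesis using s' by simp
  qed
  show False
  proof (cases "dist (t, u) ?p < d1")
    case True
    then have "s' = 1" using s1 by (simp add: s'_def)
    then have inS: "(t, u) \<in> S" using sol by simp
    then have inK: "(t, u) \<in> K" using True \<phi>u r_pos by (auto simp: K_def dist_commute)
    have "(t, u) \<notin> K1"
    proof
      assume "(t, u) \<in> K1"
      then have "r = r1" using \<theta>(4) by (simp add: r_def)
      moreover have "norm u \<le> d1" using dist_snd_le[of "(t, u)" ?p] True by simp
      ultimately show False using r1[of u] \<phi>u by simp
    qed
    then have "(t, u) \<in> K2" using inK K12(3) by blast
    then have "r = r0" "m \<le> ?\<phi> u" using \<theta>(3) m(2)[of "(t, u)"] by (auto simp: r_def)
    then show False using \<phi>u r0(2) by simp
  next
    case False
    then have rr0: "r = r0" using \<theta>(3)[of "(t, u)"] by (simp add: r_def dist_commute)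
    show False
    proof (cases "s' = 0")
      case True
      \<comment> \<open>The linear regime: \<alpha> must vanish, so \<open>t = l\<^sub>0\<close> and
        \<open>u\<close> is a multiple of \<open>x\<close> that is too short to lie outside the ball
        of radius \<open>d1\<close>.\<close>
      then have "r * (\<sigma> * (1 - ?\<phi> (w t))) = 0" using sy \<open>y = 0\<close> by (metis mult_zero_right)
      then have "\<sigma> * (1 - ?\<phi> (w t)) = 0" using r_pos by (metis less_irrefl mult_eq_0_iff)
      then have "t = l\<^sub>0" using left[OF tJ] right[OF tJ] by fastforce
      then have "u = r0 *\<^sub>R x" using u_eq g0[OF True] A0[OF tJ] wl rr0 by simp
      then have "dist (t, u) ?p = r0" using x(1) r0(1) \<open>t = l\<^sub>0\<close> by (simp add: dist_Pair_Pair)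
      then show False using False r0(4) by simp
    next
      case s'ne: False
      then have s': "s' > 0" using s01(1)[of "(t, u)"] by (simp add: s'_def)
      have "c * norm u < c * min (d1 / 2) m'" using small[OF s'] rr0 r0c by simp
      then have nu: "norm u < d1 / 2" "norm u < m'" using c by auto
      have "dist (t, u) ?p \<le> \<bar>t - l\<^sub>0\<bar> + norm u"
        using norm_Pair_le[of "t - l\<^sub>0" u] by (simp add: dist_norm)
      \<comment> \<open>A short \<open>u\<close> outside the ball leaves the distance to the
        parameter, where solutions have norm at least \<open>m'\<close>.\<close>
      then have "\<bar>t - l\<^sub>0\<bar> \<ge> d1 / 2" using False nu(1) by simp
      then have "(t, 0) \<in> T0" using tJ by (auto simp: T0_def)
      then have "m' \<le> dist (t, 0) (t, s' *\<^sub>R u)" using m'(2) sol[OF s'] by blast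
      also have "\<dots> = s' * norm u" using s' by (simp add: dist_Pair_Pair)
      also have "\<dots> \<le> 1 * norm u" using s01(2)[of "(t, u)"] by (intro mult_right_mono) (auto simp: s'_def)
      finally show False using nu(2) by simp
    qed
  qed
qed

text \<open>The previous lemma reaches every sphere of radius less than \<open>\<delta>\<close>, but
  not the boundary itself. All these continua lie in one component of the half solution set in the
  open ball; properness makes points of it on growing spheres accumulate, and the limit is on the
  boundary.\<close>

lemma unilateral_continuum:
  fixes F :: "real \<times> 'u::banach \<Rightarrow> 'v::real_normed_vector"
  defines "S \<equiv> nontrivial_solutions F" and "L \<equiv> linearization F"
  assumes \<iota>: "compact_inclusion \<iota>"
    and C1: "C1_map F" and F0: "\<And>t. F (t, 0) = 0"
    and FL: "\<And>t. L t \<in> Fredholm0"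
    and F3: "\<And>K. closed K \<Longrightarrow> bounded K \<Longrightarrow> proper_map (top_of_set K) euclidean F"
    and N: "continuous_on UNIV N" "\<And>t u. N (t, \<iota> u) = nonlinear_part F t u"
    and null: "null_space (L l\<^sub>0) = span {x}" and x: "norm x = 1" "blinfun_apply \<phi> x = 1"
    and spec: "l\<^sub>0 \<in> gen_spectrum L"
    and odd: "\<forall>\<^sub>F \<rho> in at_right 0. \<forall>L\<^sub>\<omega>. real_analytic_curve {l\<^sub>0 - \<rho>..l\<^sub>0 + \<rho>} L\<^sub>\<omega> \<and>
           A_homotopic (l\<^sub>0 - \<rho>) (l\<^sub>0 + \<rho>) L\<^sub>\<omega> L \<longrightarrow> odd (total_mult L\<^sub>\<omega> (l\<^sub>0 - \<rho>) (l\<^sub>0 + \<rho>))"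
    and c: "c > 0"
    and cone: "\<And>t u. (t, u) \<in> S \<Longrightarrow> (t, u) \<noteq> (l\<^sub>0, 0) \<Longrightarrow> (t, u) \<in> ball (l\<^sub>0, 0) \<delta> \<Longrightarrow>
       c * norm u < \<bar>blinfun_apply \<phi> u\<bar>"
    and \<delta>: "0 < \<delta>"
  obtains C where "C \<subseteq> S \<inter> ball (l\<^sub>0, 0) \<delta> \<inter> {p. blinfun_apply \<phi> (snd p) \<ge> 0}"
    "closedin (top_of_set (ball (l\<^sub>0, 0) \<delta>)) C" "connected C" "links_to_boundary C (l\<^sub>0, 0) \<delta>"
proof -
  let ?p = "(l\<^sub>0, 0) :: real \<times> 'u"
  let ?H = "{p. blinfun_apply \<phi> (snd p) \<ge> 0}"
  let ?Sp = "S \<inter> ball ?p \<delta> \<inter> ?H"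
  define C where "C = connected_component_set ?Sp ?p"
  have sub: "C \<subseteq> ?Sp" unfolding C_def by (rule connected_component_subset)
  have "?p \<in> S" using spec by (auto simp: S_def L_def nontrivial_solutions_def)
  then have pC: "?p \<in> C"
    unfolding C_def using \<delta> by (simp add: connected_component_refl blinfun.zero_right)
  have "closed S" unfolding S_def by (rule closed_nontrivial_solutions[OF C1 F0])
  then have "closed (S \<inter> ?H)"
    by (intro closed_Int closed_Collect_le continuous_intros)
  then have "closedin (top_of_set (ball ?p \<delta>)) ?Sp"
    using closedin_closed_Int[of "S \<inter> ?H" "ball ?p \<delta>"] by (simp add: Int_ac)
  then have closedin: "closedin (top_of_set (ball ?p \<delta>)) C"
    unfolding C_def using closedin_connected_component closedin_trans by blast
  have meets: "\<exists>q\<in>C. dist q ?p = d" if d: "0 < d" "d < \<delta>" for d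
  proof -
    have "connected_component_set (S \<inter> cball ?p d \<inter> ?H) ?p \<inter> sphere ?p d \<noteq> {}"
      unfolding S_def
      by (rule component_meets_sphere[OF \<iota> C1 F0 FL[unfolded L_def] F3 N null[unfolded L_def] x
            spec[unfolded L_def] odd[unfolded L_def] c cone[unfolded S_def] d])
    moreover have "connected_component_set (S \<inter> cball ?p d \<inter> ?H) ?p \<subseteq> C"
      unfolding C_def using d by (intro connected_component_mono) auto
    ultimately show ?thesis by (auto simp: dist_commute)
  qed
  \<comment> \<open>The shift by 2 keeps the radius positive already for
    \<open>n = 0\<close>.\<close>
  have "0 < \<delta> * (1 - 1 / real (n + 2)) \<and> \<delta> * (1 - 1 / real (n + 2)) < \<delta>" for n
    using \<delta> by (simp add: field_simps add_pos_nonneg)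
  then have "\<exists>q\<in>C. dist q ?p = \<delta> * (1 - 1 / real (n + 2))" for n
    using meets by blast
  then obtain q where q: "\<And>n. q n \<in> C" "\<And>n. dist (q n) ?p = \<delta> * (1 - 1 / real (n + 2))"
    by metis
  have "compact {q \<in> cball ?p \<delta>. F q \<in> {0}}"
    by (intro proper_preimage_compact F3) auto
  moreover have "q n \<in> {q \<in> cball ?p \<delta>. F q \<in> {0}}" for n
  proof -
    have "q n \<in> ?Sp" using sub q(1) by blast
    then show ?thesis using F0 by (auto simp: S_def nontrivial_solutions_def)
  qed
  ultimately obtain l r where r: "strict_mono r" "(\<lambda>n. q (r n)) \<longlonglongrightarrow> l"
    using compact_convergent_subseq[of "{q \<in> cball ?p \<delta>. F q \<in> {0}}" q] by metis
  have "l \<in> closure C"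
    unfolding closure_sequential using r(2) q(1) by (intro exI[of _ "\<lambda>n. q (r n)"]) simp
  moreover have "dist l ?p = \<delta>"
  proof -
    have "(\<lambda>n. 1 / real (n + 2)) \<longlonglongrightarrow> 0"
      using LIMSEQ_ignore_initial_segment[OF lim_1_over_n, of 2] by simp
    then have "(\<lambda>n. dist (q n) ?p) \<longlonglongrightarrow> \<delta> * (1 - 0)"
      unfolding q(2) by (intro tendsto_intros)
    from LIMSEQ_subseq_LIMSEQ[OF this r(1)]
    have "(\<lambda>n. dist (q (r n)) ?p) \<longlonglongrightarrow> \<delta>" by (simp add: o_def)
    moreover have "(\<lambda>n. dist (q (r n)) ?p) \<longlonglongrightarrow> dist l ?p"
      by (intro tendsto_intros r)
    ultimately show ?thesis using LIMSEQ_unique by blast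
  qed
  ultimately have "l \<in> closure C \<inter> frontier (ball ?p \<delta>)"
    using \<delta> by (simp add: dist_commute)
  then have "links_to_boundary C ?p \<delta>"
    unfolding links_to_boundary_def using pC by blast
  then show ?thesis
    using that[OF sub closedin] by (simp add: C_def connected_connected_component)
qed

section \<open>The two half branches\<close>

lemma span_minus_subset: "span {- x} \<subseteq> span {x}"
  by (intro span_minimal) (auto intro: span_neg span_base)

theorem theorem9p3:
  fixes \<iota> :: "'u::banach \<Rightarrow> 'v::banach"
    and F :: "real \<times> 'u \<Rightarrow> 'v"
    and l\<^sub>0 :: real and \<phi>\<^sub>0 :: 'u
    and Z :: "'u set" and \<phi>s :: "'u \<Rightarrow>\<^sub>L real"
    and \<psi> :: "'u \<Rightarrow> real" and C\<^sub>1 C\<^sub>2 \<eta> :: real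
  assumes C: "compact_inclusion \<iota>"
    and F_C1: "C1_map F"
    and F1: "\<forall>t. F (t, 0) = 0"
    and F2: "\<forall>t u. D\<^sub>u F t u \<in> Fredholm0"
    and F3: "\<forall>K. closed K \<and> bounded K \<longrightarrow> proper_map (top_of_set K) euclidean F"
    and F4: "\<exists>N :: real \<times> 'v \<Rightarrow> 'v. continuous_on UNIV N \<and>
               (\<forall>t u. N (t, \<iota> u) = nonlinear_part F t u)"
    and F5: "l\<^sub>0 isolated_in gen_spectrum (linearization F)"
            "null_space (linearization F l\<^sub>0) = span {\<phi>\<^sub>0}" "norm \<phi>\<^sub>0 = 1"
    and Z: "closed Z" "complementary (null_space (linearization F l\<^sub>0)) Z"
           "Z = null_space \<phi>s" "blinfun_apply \<phi>s \<phi>\<^sub>0 = 1"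
    and \<psi>: "continuous_on UNIV \<psi>" "\<psi> 0 = 0" "0 < C\<^sub>1" "C\<^sub>1 < C\<^sub>2"
           "\<forall>u. C\<^sub>1 * norm u \<le> \<psi> u \<and> \<psi> u \<le> C\<^sub>2 * norm u"
    and \<eta>: "0 < \<eta>" "\<eta> < 1 / C\<^sub>2"
    and odd_mult: "\<forall>\<^sub>F \<rho> in at_right 0. \<forall>L\<^sub>\<omega>.
           real_analytic_curve {l\<^sub>0 - \<rho>..l\<^sub>0 + \<rho>} L\<^sub>\<omega> \<and>
           A_homotopic (l\<^sub>0 - \<rho>) (l\<^sub>0 + \<rho>) L\<^sub>\<omega> (linearization F) \<longrightarrow>
           odd (total_mult L\<^sub>\<omega> (l\<^sub>0 - \<rho>) (l\<^sub>0 + \<rho>))"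
  shows "\<exists>\<CC> \<in> components (nontrivial_solutions F). (l\<^sub>0, 0) \<in> \<CC> \<and>
    (\<forall>\<epsilon>>0. \<forall>\<delta>>0.
       (nontrivial_solutions F - {(l\<^sub>0, 0)}) \<inter> ball (l\<^sub>0, 0) \<delta> \<subseteq> Q_cone l\<^sub>0 \<phi>s \<psi> \<epsilon> \<eta> \<longrightarrow>
       (\<exists>Cp Cm.
          Cp \<subseteq> \<CC> \<inter> ball (l\<^sub>0, 0) \<delta> \<and> Cm \<subseteq> \<CC> \<inter> ball (l\<^sub>0, 0) \<delta> \<and>
          closedin (top_of_set (ball (l\<^sub>0, 0) \<delta>)) Cp \<and> connected Cp \<and>
          closedin (top_of_set (ball (l\<^sub>0, 0) \<delta>)) Cm \<and> connected Cm \<and>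
          Cp \<subseteq> Q_cone_pos l\<^sub>0 \<phi>s \<psi> \<epsilon> \<eta> \<union> {(l\<^sub>0, 0)} \<and>
          Cm \<subseteq> Q_cone_neg l\<^sub>0 \<phi>s \<psi> \<epsilon> \<eta> \<union> {(l\<^sub>0, 0)} \<and>
          Cp \<inter> Cm = {(l\<^sub>0, 0)} \<and>
          links_to_boundary Cp (l\<^sub>0, 0) \<delta> \<and> links_to_boundary Cm (l\<^sub>0, 0) \<delta>))"
proof -
  let ?S = "nontrivial_solutions F" and ?L = "linearization F" and ?p = "(l\<^sub>0, 0) :: real \<times> 'u"
  obtain N :: "real \<times> 'v \<Rightarrow> 'v" where N: "continuous_on UNIV N"
      "\<And>t u. N (t, \<iota> u) = nonlinear_part F t u"
    using F4 by blast
  have FL: "?L t \<in> Fredholm0" for t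
    using F2 by (simp add: linearization_def)
  have spec: "l\<^sub>0 \<in> gen_spectrum ?L"
    using F5(1) by (simp add: isolated_in_def)
  then have pS: "?p \<in> ?S"
    by (auto simp: nontrivial_solutions_def)
  have F0: "F (t, 0) = 0" for t
    using F1 by simp
  have F3': "proper_map (top_of_set K) euclidean F" if "closed K" "bounded K" for K
    using F3 that by blast
  \<comment> \<open>The lower bound on \<open>\<psi>\<close> turns the cone given by
    \<open>\<psi>\<close> into a norm cone with constant \<open>\<eta> * C\<^sub>1\<close>;
    \<open>\<psi>\<close> itself returns only when the two halves are placed in
    \<open>Q_cone_pos\<close> and \<open>Q_cone_neg\<close>.\<close>
  have \<psi>0: "0 \<le> \<eta> * \<psi> u" "\<eta> * C\<^sub>1 * norm u \<le> \<eta> * \<psi> u" for u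
  proof -
    have "0 \<le> C\<^sub>1 * norm u" "C\<^sub>1 * norm u \<le> \<psi> u" using \<psi>(3,5) by auto
    then show "0 \<le> \<eta> * \<psi> u" "\<eta> * C\<^sub>1 * norm u \<le> \<eta> * \<psi> u"
      using \<eta>(1) by (auto simp: mult.assoc)
  qed
  \<comment> \<open>Fixed before \<open>\<epsilon>\<close> and \<open>\<delta>\<close>: every
    connected set of solutions through \<open>?p\<close> lies in it, so one component serves all
    radii.\<close>
  define \<CC> where "\<CC> = connected_component_set ?S ?p"
  have \<CC>: "\<CC> \<in> components ?S" "?p \<in> \<CC>"
    unfolding \<CC>_def using pS by (auto intro: componentsI)
  have sub\<CC>: "C \<subseteq> \<CC>" if "C \<subseteq> ?S" "connected C" "?p \<in> C" for C
    unfolding \<CC>_def using connected_component_maximal[OF that(3,2,1)] .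
  show ?thesis
  proof (intro bexI[of _ \<CC>] conjI allI impI \<CC>)
    fix \<epsilon> \<delta> :: real
    assume "\<epsilon> > 0" and \<delta>: "\<delta> > 0"
      and incl: "(?S - {?p}) \<inter> ball ?p \<delta> \<subseteq> Q_cone l\<^sub>0 \<phi>s \<psi> \<epsilon> \<eta>"
    have incl': "\<bar>t - l\<^sub>0\<bar> < \<epsilon> \<and> \<eta> * \<psi> u < \<bar>blinfun_apply \<phi>s u\<bar>"
      if "(t, u) \<in> ?S" "(t, u) \<noteq> ?p" "(t, u) \<in> ball ?p \<delta>" for t u
      using incl that unfolding Q_cone_def by blast
    have cone: "\<eta> * C\<^sub>1 * norm u < \<bar>blinfun_apply \<phi>s u\<bar>"
      if "(t, u) \<in> ?S" "(t, u) \<noteq> ?p" "(t, u) \<in> ball ?p \<delta>" for t u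
      using incl'[OF that] \<psi>0(2)[of u] by linarith
    have c: "\<eta> * C\<^sub>1 > 0" using \<eta>(1) \<psi>(3) by simp
    obtain Cp where Cp: "Cp \<subseteq> ?S \<inter> ball ?p \<delta> \<inter> {p. blinfun_apply \<phi>s (snd p) \<ge> 0}"
        "closedin (top_of_set (ball ?p \<delta>)) Cp" "connected Cp" "links_to_boundary Cp ?p \<delta>"
      by (rule unilateral_continuum[OF C F_C1 F0 FL F3' N F5(2,3) Z(4) spec odd_mult c cone \<delta>])
    \<comment> \<open>Changing the sign of both the functional and the kernel vector preserves the
      normalization and the kernel and exchanges the two half spaces.\<close>
    have null: "null_space (?L l\<^sub>0) = span {- \<phi>\<^sub>0}"
      using F5(2) span_minus_subset[of "- \<phi>\<^sub>0"] span_minus_subset[of \<phi>\<^sub>0] by simp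
    have "norm (- \<phi>\<^sub>0) = 1" "blinfun_apply (- \<phi>s) (- \<phi>\<^sub>0) = 1"
      using F5(3) Z(4) by (auto simp: blinfun.minus_left blinfun.minus_right)
    note x = this
    have cone': "\<eta> * C\<^sub>1 * norm u < \<bar>blinfun_apply (- \<phi>s) u\<bar>"
      if "(t, u) \<in> ?S" "(t, u) \<noteq> ?p" "(t, u) \<in> ball ?p \<delta>" for t u
      using cone[OF that] by (simp add: blinfun.minus_left)
    obtain Cm where Cm: "Cm \<subseteq> ?S \<inter> ball ?p \<delta> \<inter> {p. blinfun_apply (- \<phi>s) (snd p) \<ge> 0}"
        "closedin (top_of_set (ball ?p \<delta>)) Cm" "connected Cm" "links_to_boundary Cm ?p \<delta>"
      by (rule unilateral_continuum[OF C F_C1 F0 FL F3' N null x spec odd_mult c cone' \<delta>])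
    have pos: "Cp \<subseteq> Q_cone_pos l\<^sub>0 \<phi>s \<psi> \<epsilon> \<eta> \<union> {?p}"
    proof
      fix q assume "q \<in> Cp"
      then have "q \<in> ?S" "q \<in> ball ?p \<delta>" "blinfun_apply \<phi>s (snd q) \<ge> 0" using Cp(1) by blast+
      then show "q \<in> Q_cone_pos l\<^sub>0 \<phi>s \<psi> \<epsilon> \<eta> \<union> {?p}"
        using incl'[of "fst q" "snd q"] by (cases "q = ?p") (auto simp: Q_cone_pos_def case_prod_beta')
    qed
    have neg: "Cm \<subseteq> Q_cone_neg l\<^sub>0 \<phi>s \<psi> \<epsilon> \<eta> \<union> {?p}"
    proof
      fix q assume "q \<in> Cm"
      then have "q \<in> ?S" "q \<in> ball ?p \<delta>" "blinfun_apply \<phi>s (snd q) \<le> 0"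
        using Cm(1) by (auto simp: blinfun.minus_left)
      then show "q \<in> Q_cone_neg l\<^sub>0 \<phi>s \<psi> \<epsilon> \<eta> \<union> {?p}"
        using incl'[of "fst q" "snd q"] by (cases "q = ?p") (auto simp: Q_cone_neg_def case_prod_beta')
    qed
    have disj: "Q_cone_pos l\<^sub>0 \<phi>s \<psi> \<epsilon> \<eta> \<inter> Q_cone_neg l\<^sub>0 \<phi>s \<psi> \<epsilon> \<eta> = {}"
    proof -
      have False if "\<eta> * \<psi> u < blinfun_apply \<phi>s u" "blinfun_apply \<phi>s u < - \<eta> * \<psi> u" for u
        using that \<psi>0(1)[of u] by simp
      then show ?thesis unfolding Q_cone_pos_def Q_cone_neg_def by blast
    qed
    have pCpm: "?p \<in> Cp" "?p \<in> Cm" using Cp(4) Cm(4) by (auto simp: links_to_boundary_def)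
    have "Cp \<inter> Cm = {?p}"
      using pos neg disj pCpm by blast
    moreover have "Cp \<subseteq> \<CC> \<inter> ball ?p \<delta>" "Cm \<subseteq> \<CC> \<inter> ball ?p \<delta>"
      using sub\<CC>[of Cp] sub\<CC>[of Cm] Cp Cm pCpm by blast+
    ultimately show "\<exists>Cp Cm.
          Cp \<subseteq> \<CC> \<inter> ball ?p \<delta> \<and> Cm \<subseteq> \<CC> \<inter> ball ?p \<delta> \<and>
          closedin (top_of_set (ball ?p \<delta>)) Cp \<and> connected Cp \<and>
          closedin (top_of_set (ball ?p \<delta>)) Cm \<and> connected Cm \<and>
          Cp \<subseteq> Q_cone_pos l\<^sub>0 \<phi>s \<psi> \<epsilon> \<eta> \<union> {?p} \<and>
          Cm \<subseteq> Q_cone_neg l\<^sub>0 \<phi>s \<psi> \<epsilon> \<eta> \<union> {?p} \<and>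
          Cp \<inter> Cm = {?p} \<and>
          links_to_boundary Cp ?p \<delta> \<and> links_to_boundary Cm ?p \<delta>"
      using Cp(2-4) Cm(2-4) pos neg by (intro exI[of _ Cp] exI[of _ Cm] conjI)
  qed
qed

end
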